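(* Let $n\ge2$ and $0\le k<n$ be integers, let $1<p<\infty$, $1\le q<\infty$, and let $\gamma\ge0$, $\beta\ge0$. Let $X=L_q(\mathrm{Log})^{\gamma}L$ and $Y=L_p(\mathrm{Log})^{-\beta}L$ be the (generalized) Zygmund spaces. Then the Wirtinger functional $$W^o(\Delta;p,q;n,k)=\sup_{f\in Z(n,k),\ f\in L_{q,+}}\ \sup_{f\in L_{p,-}}\left[\frac{\|T_\Delta f\|X}{\phi(X,\Delta)}:\frac{\Delta^n\,\|(T_\Delta f)^{(n)}\|Y}{\phi(Y,\Delta)}\right]$$ (the supremum being over all such $f$ with $f^{(n)}\ne0$) is bounded uniformly in $\Delta$: $$\sup_{\Delta\in(0,\infty)}W^o(\Delta;p,q;n,k)=C(p,q;n,k)<\infty .$$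
   Context: **The class $Z(n,k)$.** $Z(n,k)$ is the set of functions $f:[0,1]\to\mathbb{R}$ having a generalized derivative $f^{(n)}$ of order $n$ on $[0,1]$ with $f^{(i)}(0)=0$ for $i=0,\dots,k-1$ and $f^{(j)}(1)=0$ for $j=0,\dots,n-k-1$. Functions are extended by zero to $x>1$. **Dilation.** $T_\Delta[f](x)=f(x/\Delta)$ for $\Delta>0$. The derivative $(T_\Delta f)^{(n)}$ is taken on $(0,\Delta)$, so that $\Delta^n(T_\Delta f)^{(n)}=T_\Delta(f^{(n)})$ there. **Zygmund spaces.** $X=L_q(\mathrm{Log})^\gamma L$ is the Orlicz space over $(0,\Delta)$ (with Lebesgue measure $m$) with Orlicz function $$\Phi(q,\gamma;u)=|u|^q\,[\log(C(q,\gamma)+|u|)]^{\gamma},$$ and $Y=L_p(\mathrm{Log})^{-\beta}L$ is the Orlicz space over $(0,\Delta)$ with Orlicz function $\Phi(p,-\beta;u)=|u|^p[\log(C(p,-\beta)+|u|)]^{-\beta}$, where $C(q,\gamma)$ and $C(p,-\beta)$ are sufficiently large positive constants. The norm in the Orlicz space $L(\Phi)$ over $(0,\Delta)$ may be taken as $\|h\|L(\Phi)=\inf_{v>0}v^{-1}\left[1+\int_0^\Delta\Phi(v\,h(x))\,dx\right]$. **Fundamental function.** For a rearrangement invariant space $X$ over $(0,\Delta)$, $\phi(X,\delta)=\sup\{\|I(A)\|X:\ m(A)\le\delta\}$, where $I(A)$ is the indicator function of $A$; $\phi(X,\Delta)$ is its value at $\delta=\Delta$. **Auxiliary classes.** $L_{q,+}=\bigcup_{\epsilon\in(0,1)}L_{q+\epsilon}$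 and $L_{p,-}=\bigcup_{\delta\in(0,\,0.5(p+1))}L_{p-\delta}$, where $L_r$ is the set of measurable $f$ on $[0,1]$ with $\int|f|^r\,dx<\infty$. **Conventions.** $u:v$ denotes the quotient $u/v$ (equal to $0$ when $v=\infty$ and $u<\infty$). The numbers $\beta,\gamma$ are fixed, and the constant $C(p,q;n,k)$ may also depend on them. *)

theory Defs
  imports "HOL-Analysis.Analysis"
begin

definition test_function :: "real \<Rightarrow> real \<Rightarrow> (real \<Rightarrow> real) \<Rightarrow> bool" where
  "test_function a b \<phi> \<longleftrightarrow>
     (\<forall>m. (deriv ^^ m) \<phi> differentiable_on UNIV) \<and>
     (\<exists>c d. a < c \<and> d < b \<and> (\<forall>x. x \<notin> {c..d} \<longrightarrow> \<phi> x = 0))"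

text \<open>Generalized (Sobolev) derivatives on the closed interval \<open>[a, b]\<close>: local integrability
  on a compact interval is integrability.\<close>

definition has_gderiv ::
  "real \<Rightarrow> real \<Rightarrow> nat \<Rightarrow> (real \<Rightarrow> real) \<Rightarrow> (real \<Rightarrow> real) \<Rightarrow> bool" where
  "has_gderiv a b n f g \<longleftrightarrow>
     set_integrable lebesgue {a..b} f \<and> set_integrable lebesgue {a..b} g \<and>
     (\<forall>\<phi>. test_function a b \<phi> \<longrightarrow>
        (LINT x:{a..b}|lebesgue. f x * (deriv ^^ n) \<phi> x) =
        (-1) ^ n * (LINT x:{a..b}|lebesgue. g x * \<phi> x))"

text \<open>The generalized derivative is determined only almost everywhere; every use below is
  insensitive to the choice of representative.\<close>

definition gderiv :: "real \<Rightarrow> real \<Rightarrow> nat \<Rightarrow> (real \<Rightarrow> real) \<Rightarrow> real \<Rightarrow> real" where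
  "gderiv a b n f = (SOME g. has_gderiv a b n f g)"

text \<open>The class \<open>Z(n, k)\<close>. A function on \<open>[0, 1]\<close> with a generalized derivative of order \<open>n\<close> has
  generalized derivatives of all lower orders, with representatives that are continuous
  on \<open>[0, 1]\<close>. The boundary values are those of the continuous representatives \<open>D i\<close>, and \<open>f\<close>
  itself is taken to be the continuous one. Only the values of \<open>f\<close> on \<open>[0, 1]\<close> matter.\<close>

definition Z_class :: "nat \<Rightarrow> nat \<Rightarrow> (real \<Rightarrow> real) set" where
  "Z_class n k = {f. \<exists>D.
     (\<forall>x\<in>{0..1}. D 0 x = f x) \<and>
     (\<forall>i\<le>n. has_gderiv 0 1 i f (D i)) \<and>
     (\<forall>i<n. continuous_on {0..1} (D i)) \<and>
     (\<forall>i<k. D i 0 = 0) \<and>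
     (\<forall>j<n - k. D j 1 = 0)}"

definition dilation :: "real \<Rightarrow> (real \<Rightarrow> real) \<Rightarrow> real \<Rightarrow> real" where
  "dilation \<Delta> f x = (if x / \<Delta> \<in> {0..1} then f (x / \<Delta>) else 0)"

text \<open>\<open>C\<close> stands for the constant \<open>C(r, s)\<close>.\<close>

definition zygmund_fun :: "real \<Rightarrow> real \<Rightarrow> real \<Rightarrow> real \<Rightarrow> real" where
  "zygmund_fun C r s u = \<bar>u\<bar> powr r * ln (C + \<bar>u\<bar>) powr s"

definition orlicz_norm :: "real \<Rightarrow> (real \<Rightarrow> real) \<Rightarrow> (real \<Rightarrow> real) \<Rightarrow> ennreal" where
  "orlicz_norm \<Delta> \<Phi> h =
     (INF v\<in>{0<..}. ennreal (1 / v) *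
        (1 + (\<integral>\<^sup>+x\<in>{0<..<\<Delta>}. ennreal (\<Phi> (v * h x)) \<partial>lebesgue)))"

definition fundamental_function :: "real \<Rightarrow> (real \<Rightarrow> real) \<Rightarrow> real \<Rightarrow> ennreal" where
  "fundamental_function \<Delta> \<Phi> \<delta> =
     (SUP A\<in>{A \<in> sets lebesgue. A \<subseteq> {0<..<\<Delta>} \<and> emeasure lebesgue A \<le> ennreal \<delta>}.
        orlicz_norm \<Delta> \<Phi> (indicator A))"

definition L_space :: "real \<Rightarrow> (real \<Rightarrow> real) set" where
  "L_space r = {f. f \<in> borel_measurable (lebesgue_on {0..1}) \<and>
     (\<integral>\<^sup>+x\<in>{0..1}. ennreal (\<bar>f x\<bar> powr r) \<partial>lebesgue) < \<infinity>}"

definition L_plus :: "real \<Rightarrow> (real \<Rightarrow> real) set" where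
  "L_plus q = (\<Union>\<epsilon>\<in>{0<..<1}. L_space (q + \<epsilon>))"

definition L_minus :: "real \<Rightarrow> (real \<Rightarrow> real) set" where
  "L_minus p = (\<Union>\<delta>\<in>{0<..<(p + 1) / 2}. L_space (p - \<delta>))"

text \<open>\<open>CX\<close> and \<open>CY\<close> stand for \<open>C(q, \<gamma>)\<close> and \<open>C(p, -\<beta>)\<close>. Division in \<^typ>\<open>ennreal\<close>
  satisfies \<open>u / \<infinity> = 0\<close>, as required of the quotient \<open>u : v\<close>.\<close>

definition wirtinger ::
  "real \<Rightarrow> real \<Rightarrow> real \<Rightarrow> real \<Rightarrow> real \<Rightarrow> real \<Rightarrow> real \<Rightarrow> nat \<Rightarrow> nat \<Rightarrow> ennreal" where
  "wirtinger CX CY \<gamma> \<beta> \<Delta> p q n k =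
     (let X = zygmund_fun CX q \<gamma>; Y = zygmund_fun CY p (- \<beta>) in
      SUP f\<in>{f \<in> Z_class n k \<inter> L_plus q \<inter> L_minus p.
               \<not> (AE x in lebesgue. x \<in> {0..1} \<longrightarrow> gderiv 0 1 n f x = 0)}.
        (orlicz_norm \<Delta> X (dilation \<Delta> f) / fundamental_function \<Delta> X \<Delta>) /
        (ennreal (\<Delta> ^ n) * orlicz_norm \<Delta> Y (gderiv 0 \<Delta> n (dilation \<Delta> f))
           / fundamental_function \<Delta> Y \<Delta>))"

end

theory Submission imports Defs
begin

text \<open>
  The functional is bounded by 2 for every \<open>\<Delta>\<close>; the constant comes from the following two
  estimates, which meet in the mean of the absolute value of the derivative.

  Upper estimate. The boundary conditions prescribe \<open>n\<close> zeros, counted with multiplicity, so by Rolle's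
  theorem each of \<open>f, f', \<dots>, f\<^sup>(\<^sup>n\<^sup>-\<^sup>1\<^sup>)\<close> vanishes somewhere on \<open>[0, 1]\<close>
  (\<open>boundary_zeros_count\<close>). Integrating up from these zeros gives \<open>\<bar>f\<bar> \<le> \<integral> \<bar>f\<^sup>(\<^sup>n\<^sup>)\<bar>\<close>, the
  integral being over \<open>[0, 1]\<close>. In terms of the
  \<open>n\<close>-th derivative \<open>g\<close> of the dilated function on \<open>(0, \<Delta>)\<close> this reads \<open>\<bar>f\<bar> \<le> \<Delta> ^ n * J\<close>, where
  \<open>J\<close> is the mean of \<open>\<bar>g\<bar>\<close> over \<open>(0, \<Delta>)\<close> (\<open>Z_class_sup_bound\<close>). As the norm of \<open>X\<close> is
  monotone and \<open>\<phi>(X, \<Delta>)\<close> is the norm of the constant 1, the first quotient is at most \<open>\<Delta> ^ n * J\<close>.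

  Lower estimate. By a version of Jensen's inequality the norm of \<open>g\<close> in \<open>Y\<close> is at least \<open>J / 2\<close> times the
  norm of the constant 1, which is \<open>\<phi>(Y, \<Delta>)\<close> (\<open>orlicz_norm_ge_mean\<close>). It only uses that
  \<open>\<Phi> u / u\<close> is nondecreasing, and for the Zygmund function with a negative logarithmic exponent this
  holds when the constant inside the logarithm is large (\<open>orlicz_like_zygmund_fun\<close>).

  The derivatives are generalized ones, defined by test functions, while Rolle's theorem is about
  classical derivatives. The two are connected by \<open>weak_deriv_FTC\<close>: smooth approximations of the indicator of
  an interval, used as test functions, yield the fundamental theorem of calculus.
\<close>

section \<open>Smooth bumps and steps\<close>
definition smooth_fun :: "(real \<Rightarrow> real) \<Rightarrow> bool" where
  "smooth_fun f \<longleftrightarrow> (\<forall>m. (deriv ^^ m) f differentiable_on UNIV)"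

text \<open>This avoids formulas for higher derivatives: a class of functions closed under differentiation
  consists of smooth functions.\<close>
lemma smooth_funI_coinduct:
  assumes "R f"
    and step: "\<And>f. R f \<Longrightarrow> \<exists>f'. R f' \<and> (\<forall>x. (f has_real_derivative f' x) (at x))"
  shows "smooth_fun f"
proof -
  have "R ((deriv ^^ m) f)" for m
  proof (induction m)
    case (Suc m)
    obtain f' where f': "R f'" "\<And>x. ((deriv ^^ m) f has_real_derivative f' x) (at x)"
      using step[OF Suc] by blast
    have "(deriv ^^ Suc m) f = f'"
      using DERIV_imp_deriv[OF f'(2)] by (simp add: fun_eq_iff)
    then show ?case using f'(1) by simp
  qed (use assms in simp)
  then show ?thesis
    unfolding smooth_fun_def
    by (meson step differentiable_on_def real_differentiable_def differentiable_at_withinI)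
qed

lemma smooth_fun_DERIV:
  assumes "smooth_fun f"
  shows "((deriv ^^ m) f has_real_derivative (deriv ^^ Suc m) f x) (at x)"
proof -
  have "(deriv ^^ m) f differentiable (at x)"
    using assms by (simp add: smooth_fun_def differentiable_on_def)
  then show ?thesis
    by (simp add: DERIV_deriv_iff_real_differentiable)
qed

lemma smooth_fun_DERIV_0:
  assumes "smooth_fun f"
  shows "(f has_real_derivative deriv f x) (at x)"
  using smooth_fun_DERIV[OF assms, of 0] by simp

lemma smooth_fun_deriv: "smooth_fun f \<Longrightarrow> smooth_fun (deriv f)"
  unfolding smooth_fun_def by (metis funpow_Suc_right o_apply)

lemma smooth_fun_antideriv:
  assumes "smooth_fun g" "\<And>x. (f has_real_derivative g x) (at x)"
  shows "smooth_fun f"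
proof (rule smooth_funI_coinduct[where R = "\<lambda>h. h = f \<or> smooth_fun h"])
  fix h assume "h = f \<or> smooth_fun h"
  then show "\<exists>h'. (h' = f \<or> smooth_fun h') \<and> (\<forall>x. (h has_real_derivative h' x) (at x))"
    using assms smooth_fun_deriv smooth_fun_DERIV_0 by metis
qed simp

lemma smooth_fun_diff:
  assumes "smooth_fun f" "smooth_fun g"
  shows "smooth_fun (\<lambda>x. f x - g x)"
proof (rule smooth_funI_coinduct[where
        R = "\<lambda>h. \<exists>f g. smooth_fun f \<and> smooth_fun g \<and> h = (\<lambda>x. f x - g x)"])
  fix h assume "\<exists>f g. smooth_fun f \<and> smooth_fun g \<and> h = (\<lambda>x. f x - g x)"
  then obtain f g where fg: "smooth_fun f" "smooth_fun g" "h = (\<lambda>x. f x - g x)" by blast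
  then show "\<exists>h'. (\<exists>f g. smooth_fun f \<and> smooth_fun g \<and> h' = (\<lambda>x. f x - g x)) \<and>
      (\<forall>x. (h has_real_derivative h' x) (at x))"
    by (intro exI[of _ "\<lambda>x. deriv f x - deriv g x"])
       (auto intro!: derivative_intros smooth_fun_deriv smooth_fun_DERIV_0)
qed (use assms in blast)

lemma higher_deriv_rescale:
  assumes "smooth_fun f"
  shows "(deriv ^^ m) (\<lambda>x. f (s * x)) = (\<lambda>x. s ^ m * (deriv ^^ m) f (s * x))"
proof (induction m)
  case (Suc m)
  have "((\<lambda>x. s ^ m * (deriv ^^ m) f (s * x)) has_real_derivative
      s ^ Suc m * (deriv ^^ Suc m) f (s * x)) (at x)" for x
    by (rule derivative_eq_intros DERIV_chain2[where g = "\<lambda>x. s * x"] smooth_fun_DERIV assms refl | simp)+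
  then have "deriv (\<lambda>x. s ^ m * (deriv ^^ m) f (s * x)) x =
      s ^ Suc m * (deriv ^^ Suc m) f (s * x)" for x
    by (rule DERIV_imp_deriv)
  then show ?case
    by (simp only: funpow.simps o_apply Suc)
qed simp

lemma smooth_fun_rescale:
  assumes "smooth_fun f"
  shows "smooth_fun (\<lambda>x. f (s * x))"
  unfolding smooth_fun_def
proof
  fix m
  have "((\<lambda>x. s ^ m * (deriv ^^ m) f (s * x)) has_real_derivative
      s ^ Suc m * (deriv ^^ Suc m) f (s * x)) (at x)" for x
    by (rule derivative_eq_intros DERIV_chain2[where g = "\<lambda>x. s * x"] smooth_fun_DERIV assms refl | simp)+
  then show "(deriv ^^ m) (\<lambda>x. f (s * x)) differentiable_on UNIV"
    unfolding higher_deriv_rescale[OF assms] differentiable_on_def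
    by (meson real_differentiable_def differentiable_at_withinI)
qed

text \<open>This gives the derivative of a bump at the ends of its support, where the two formulas that
  define it meet.\<close>
lemma DERIV_0_of_quadratic_bound:
  fixes f :: "real \<Rightarrow> real"
  assumes "\<And>x. \<bar>f x\<bar> \<le> K * (x - c)\<^sup>2"
  shows "(f has_real_derivative 0) (at c)"
proof -
  have fc: "f c = 0" using assms[of c] by simp
  have "((\<lambda>h. (f (c + h) - f c) / h) \<longlongrightarrow> 0) (at 0)"
  proof (rule Lim_null_comparison)
    show "\<forall>\<^sub>F h in at 0. norm ((f (c + h) - f c) / h) \<le> K * \<bar>h\<bar>"
    proof (rule eventually_at_filter[THEN iffD2, OF eventuallyI], intro impI)
      fix h :: real assume "h \<noteq> 0"
      have "\<bar>f (c + h)\<bar> \<le> (K * \<bar>h\<bar>) * \<bar>h\<bar>"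
        using assms[of "c + h"] by (simp add: power2_eq_square mult.assoc)
      then show "norm ((f (c + h) - f c) / h) \<le> K * \<bar>h\<bar>"
        using \<open>h \<noteq> 0\<close> fc by (simp add: divide_le_eq)
    qed
    show "((\<lambda>h. K * \<bar>h\<bar>) \<longlongrightarrow> 0) (at 0)"
      by (auto intro!: tendsto_eq_intros)
  qed
  then show ?thesis by (simp add: DERIV_def)
qed

lemma power_div_fact_le_exp:
  fixes x :: real
  assumes "0 \<le> x"
  shows "x ^ m / fact m \<le> exp x"
proof -
  have "(\<Sum>n\<in>{m}. x ^ n / fact n) \<le> exp x"
    unfolding exp_def using summable_exp[of x] assms
    by (intro sum_le_suminf[THEN order_trans, OF _ _ _ eq_refl])
       (auto simp: scaleR_conv_of_real field_simps)
  then show ?thesis by simp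
qed

text \<open>The derivatives of the bump \<open>exp (- 1 / ((x - c) (d - x)))\<close> are its products with rational
  functions whose poles are at \<open>c\<close> and \<open>d\<close>. With these factors, given by \<open>P\<close> and \<open>N\<close>, the
  family is closed under differentiation.\<close>
definition bump_fun :: "real \<Rightarrow> real \<Rightarrow> real poly \<Rightarrow> nat \<Rightarrow> real \<Rightarrow> real" where
  "bump_fun c d P N x =
     (if c < x \<and> x < d
      then poly P x * exp (- 1 / ((x - c) * (d - x))) / ((x - c) * (d - x)) ^ N else 0)"

text \<open>With \<open>w = (x - c) (d - x)\<close>, the series of the exponential gives
  \<open>exp (- 1 / w) \<le> (N + 2)! w ^ (N + 2)\<close>, which beats the pole of order \<open>N\<close> with two powers
  to spare.\<close>
lemma bump_fun_bound:
  obtains K where "0 \<le> K" "\<And>x. c < x \<Longrightarrow> x < d \<Longrightarrow> \<bar>bump_fun c d P N x\<bar> \<le> K * ((x - c) * (d - x))\<^sup>2"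
proof -
  have "bounded (poly P ` {c..d})"
    by (intro compact_imp_bounded compact_continuous_image continuous_intros) auto
  then obtain B where "0 < B" "\<forall>y\<in>poly P ` {c..d}. norm y \<le> B"
    by (meson bounded_pos)
  then have B: "\<And>x. x \<in> {c..d} \<Longrightarrow> \<bar>poly P x\<bar> \<le> B" "0 < B"
    by auto
  show thesis
  proof (rule that[of "B * fact (N + 2)"])
    fix x assume x: "c < x" "x < d"
    define w where "w = (x - c) * (d - x)"
    have w: "w > 0" using x by (simp add: w_def)
    have "(1 / w) ^ (N + 2) / fact (N + 2) \<le> exp (1 / w)"
      using w by (intro power_div_fact_le_exp) auto
    then have "exp (- 1 / w) \<le> fact (N + 2) * w ^ (N + 2)"
      using w by (simp add: exp_minus power_one_over field_simps del: fact_Suc power_Suc power_add)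
    then have e: "exp (- 1 / w) / w ^ N \<le> fact (N + 2) * w\<^sup>2"
      using w by (simp add: divide_le_eq power_add power2_eq_square mult_ac)
    have "\<bar>bump_fun c d P N x\<bar> = \<bar>poly P x\<bar> * (exp (- 1 / w) / w ^ N)"
      using x w by (simp add: bump_fun_def w_def[symmetric] abs_mult)
    also have "\<dots> \<le> B * (fact (N + 2) * w\<^sup>2)"
      using x w by (intro mult_mono B e less_imp_le[OF B(2)]) auto
    finally show "\<bar>bump_fun c d P N x\<bar> \<le> B * fact (N + 2) * ((x - c) * (d - x))\<^sup>2"
      by (simp add: w_def mult.assoc)
  qed (use B in auto)
qed

text \<open>The polynomial \<open>w\<close> is \<open>(x - c) (d - x)\<close> expanded and \<open>w'\<close> is its derivative; inside the interval
  the formula is the quotient rule over the common denominator \<open>w ^ (N + 2)\<close>.\<close>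
lemma bump_fun_DERIV:
  fixes c d :: real
  assumes "c < d"
  defines "w \<equiv> [: - (c * d), c + d, - 1 :]"
  defines "w' \<equiv> [: c + d, - 2 :]"
  shows "(bump_fun c d P N has_real_derivative
     bump_fun c d (pderiv P * w\<^sup>2 + P * w' - of_nat N * P * w * w') (N + 2) x) (at x)"
proof -
  have w: "(y - c) * (d - y) = poly w y" for y
    by (simp add: w_def algebra_simps)
  have pd: "pderiv w = w'"
    by (simp add: w_def w'_def pderiv_pCons)
  consider "c < x \<and> x < d" | "x < c \<or> d < x" | "x = c" | "x = d" by linarith
  then show ?thesis
  proof cases
    case 1
    have wp: "poly w x > 0" using 1 by (simp flip: w)
    have "((\<lambda>x. poly P x * exp (- 1 / poly w x) / poly w x ^ N) has_real_derivative
        poly (pderiv P * w\<^sup>2 + P * w' - of_nat N * P * w * w') x *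
          exp (- 1 / poly w x) / poly w x ^ (N + 2)) (at x)"
    proof -
      have "real N * poly w x ^ (N - 1) = real N * poly w x ^ N / poly w x"
        using wp by (cases N) auto
      then have "real N * (poly (pderiv w) x * poly w x ^ (N - Suc 0)) =
          real N * poly w x ^ N / poly w x * poly w' x"
        by (metis One_nat_def mult.assoc mult.commute pd)
      then have pow: "((\<lambda>x. poly w x ^ N) has_real_derivative
          real N * poly w x ^ N / poly w x * poly w' x) (at x)"
        using DERIV_power[OF poly_DERIV[of w x], of N] by simp
      have "((\<lambda>x. exp (- 1 / poly w x)) has_real_derivative
          exp (- 1 / poly w x) * (poly w' x / (poly w x)\<^sup>2)) (at x)"
        using wp by (auto intro!: derivative_eq_intros poly_DERIV simp: pd power2_eq_square)
      note DERIV_divide[OF DERIV_mult[OF poly_DERIV[of P x] this] pow]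
      then show ?thesis
        by (rule DERIV_cong) (use wp in \<open>auto simp: field_simps power2_eq_square power_add\<close>)
    qed
    then show ?thesis
    proof (rule has_field_derivative_transform_within_open[where S = "{c<..<d}", THEN DERIV_cong])
    qed (use 1 in \<open>auto simp: bump_fun_def w\<close>)
  next
    case 2
    have "((\<lambda>x. 0) has_real_derivative 0) (at x)" by simp
    then show ?thesis
      by (rule has_field_derivative_transform_within_open[where S = "{..<c} \<union> {d<..}", THEN DERIV_cong])
         (use 2 assms in \<open>auto simp: bump_fun_def\<close>)
  next
    case 3
    obtain K where K: "0 \<le> K"
      "\<And>y. c < y \<Longrightarrow> y < d \<Longrightarrow> \<bar>bump_fun c d P N y\<bar> \<le> K * ((y - c) * (d - y))\<^sup>2"
      using bump_fun_bound by blast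
    have "\<bar>bump_fun c d P N y\<bar> \<le> K * (d - c)\<^sup>2 * (y - c)\<^sup>2" for y
    proof (cases "c < y \<and> y < d")
      case True
      have "K * ((y - c) * (d - y))\<^sup>2 \<le> K * ((y - c) * (d - c))\<^sup>2"
        using True K(1) by (intro mult_left_mono power_mono) auto
      then show ?thesis
        using K(2)[of y] True by (simp add: power_mult_distrib mult_ac)
    qed (use K(1) in \<open>auto simp: bump_fun_def\<close>)
    from DERIV_0_of_quadratic_bound[OF this] show ?thesis
      unfolding 3 using bump_fun_def[of c d _ _ c] by simp
  next
    case 4
    obtain K where K: "0 \<le> K"
      "\<And>y. c < y \<Longrightarrow> y < d \<Longrightarrow> \<bar>bump_fun c d P N y\<bar> \<le> K * ((y - c) * (d - y))\<^sup>2"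
      using bump_fun_bound by blast
    have "\<bar>bump_fun c d P N y\<bar> \<le> K * (d - c)\<^sup>2 * (y - d)\<^sup>2" for y
    proof (cases "c < y \<and> y < d")
      case True
      have "K * ((y - c) * (d - y))\<^sup>2 \<le> K * ((d - c) * (d - y))\<^sup>2"
        using True K(1) by (intro mult_left_mono power_mono) auto
      then show ?thesis
        using K(2)[of y] True by (simp add: power_mult_distrib mult_ac power2_commute[of y d])
    qed (use K(1) in \<open>auto simp: bump_fun_def\<close>)
    from DERIV_0_of_quadratic_bound[OF this] show ?thesis
      unfolding 4 using bump_fun_def[of c d _ _ d] by simp
  qed
qed

lemma smooth_bump_fun:
  assumes "c < d"
  shows "smooth_fun (bump_fun c d P N)"
proof (rule smooth_funI_coinduct[where R = "\<lambda>f. \<exists>P N. f = bump_fun c d P N"])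
  fix f assume "\<exists>P N. f = bump_fun c d P N"
  then show "\<exists>f'. (\<exists>P N. f' = bump_fun c d P N) \<and> (\<forall>x. (f has_real_derivative f' x) (at x))"
    using bump_fun_DERIV[OF assms] by blast
qed blast

lemma DERIV_zero_left:
  fixes f :: "real \<Rightarrow> real"
  assumes "\<And>x. x < c \<Longrightarrow> f x = k" "x < c"
  shows "(f has_real_derivative 0) (at x)"
  by (rule has_field_derivative_transform_within_open[where f = "\<lambda>_. k" and S = "{..<c}"])
     (use assms in auto)

text \<open>The normalised antiderivative of a bump. Differences of two such steps serve as test functions
  approximating the indicator of an interval, and \<open>\<rho>\<close> is then a nonnegative kernel of mass one.\<close>
lemma smooth_step_exists:
  assumes "lo < hi"
  obtains \<sigma> \<rho> :: "real \<Rightarrow> real" where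
    "smooth_fun \<sigma>" "continuous_on UNIV \<rho>" "\<And>x. (\<sigma> has_real_derivative \<rho> x) (at x)" "\<And>x. 0 \<le> \<rho> x"
    "\<And>x. x \<notin> {lo<..<hi} \<Longrightarrow> \<rho> x = 0" "\<And>x. x \<le> lo \<Longrightarrow> \<sigma> x = 0" "\<And>x. hi \<le> x \<Longrightarrow> \<sigma> x = 1"
    "\<And>x. 0 \<le> \<sigma> x" "\<And>x. \<sigma> x \<le> 1"
proof -
  define b where "b = bump_fun lo hi 1 0"
  have sb: "smooth_fun b" unfolding b_def by (rule smooth_bump_fun[OF assms])
  have b0: "b x = 0" if "x \<notin> {lo<..<hi}" for x
    using that by (auto simp: b_def bump_fun_def)
  have bpos: "b x > 0" if "x \<in> {lo<..<hi}" for x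
    using that by (auto simp: b_def bump_fun_def)
  have bnn: "b x \<ge> 0" for x using b0 bpos by (cases "x \<in> {lo<..<hi}") (auto intro: less_imp_le)
  have cb: "continuous_on S b" for S
    using smooth_fun_DERIV_0[OF sb]
    by (meson DERIV_isCont continuous_at_imp_continuous_on)
  define S where "S = (\<lambda>x. integral {lo - 1..x} b)"
  have S0: "S x = 0" if "x \<le> lo" for x
  proof -
    have "S x = integral {lo - 1..x} (\<lambda>_. 0)"
      unfolding S_def by (rule integral_cong) (use that b0 in auto)
    then show ?thesis by simp
  qed
  have dS: "(S has_real_derivative b x) (at x)" for x
  proof (cases "x < lo")
    case True
    then show ?thesis
      using DERIV_zero_left[of lo S 0 x] S0 b0[of x] by simp
  next
    case False
    have "((\<lambda>u. integral {lo - 1..u} b) has_real_derivative b x) (at x within {lo - 1..x + 1})"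
      using False by (intro integral_has_real_derivative cb) auto
    then have "((\<lambda>u. integral {lo - 1..u} b) has_real_derivative b x) (at x)"
      using False by (subst (asm) at_within_interior) auto
    then show ?thesis by (simp add: S_def)
  qed
  have mono: "S x \<le> S y" if "x \<le> y" for x y
    using DERIV_nonneg_imp_nondecreasing[OF that] dS bnn by blast
  have const: "S x = S hi" if "hi \<le> x" for x
  proof (cases "hi = x")
    case False
    then have "hi < x" using that by simp
    then obtain z where "hi < z" "z < x" "S x - S hi = (x - hi) * b z"
      using MVT2[of hi x S b] dS by blast
    then show ?thesis using b0[of z] by simp
  qed simp
  obtain z where "lo < z" "z < hi" "S hi - S lo = (hi - lo) * b z"
    using MVT2[of lo hi S b] assms dS by auto
  then have Shi: "S hi > 0" using bpos[of z] S0[of lo] assms by simp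
  define \<sigma> where "\<sigma> = (\<lambda>x. S x / S hi)"
  define \<rho> where "\<rho> = (\<lambda>x. b x / S hi)"
  have d: "(\<sigma> has_real_derivative \<rho> x) (at x)" for x
    unfolding \<sigma>_def \<rho>_def using Shi by (intro DERIV_cdivide dS)
  have \<sigma>: "smooth_fun \<sigma>"
  proof (rule smooth_fun_antideriv[OF _ d])
    show "smooth_fun \<rho>"
    proof -
      have "\<rho> = bump_fun lo hi [:1 / S hi:] 0"
        by (auto simp: \<rho>_def b_def bump_fun_def)
      then show ?thesis using smooth_bump_fun[OF assms] by simp
    qed
  qed
  show thesis
  proof (rule that[OF \<sigma> _ d])
    show "continuous_on UNIV \<rho>" unfolding \<rho>_def using Shi by (intro continuous_intros cb) auto
    show "0 \<le> \<rho> x" for x using bnn Shi by (simp add: \<rho>_def)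
    show "\<rho> x = 0" if "x \<notin> {lo<..<hi}" for x using b0[OF that] by (simp add: \<rho>_def)
    show "\<sigma> x = 0" if "x \<le> lo" for x using S0[OF that] by (simp add: \<sigma>_def)
    show "\<sigma> x = 1" if "hi \<le> x" for x using const[OF that] Shi by (simp add: \<sigma>_def)
    show "0 \<le> \<sigma> x" for x
      using mono[of "min x lo" x] S0[of "min x lo"] Shi by (simp add: \<sigma>_def)
    show "\<sigma> x \<le> 1" for x
      using mono[of x "max x hi"] const[of "max x hi"] Shi by (simp add: \<sigma>_def)
  qed
qed

section \<open>From generalized derivatives to classical ones\<close>
lemma integral_against_kernel_near:
  fixes F \<rho> :: "real \<Rightarrow> real"
  assumes cF: "continuous_on {l..r} F" and c\<rho>: "continuous_on {l..r} \<rho>"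
    and nn: "\<And>t. 0 \<le> \<rho> t"
    and one: "integral {l..r} \<rho> = 1"
    and near: "\<And>t. t \<in> {l..r} \<Longrightarrow> \<rho> t \<noteq> 0 \<Longrightarrow> \<bar>F t - c\<bar> \<le> e"
  shows "\<bar>integral {l..r} (\<lambda>t. F t * \<rho> t) - c\<bar> \<le> e"
proof -
  have int: "(\<lambda>t. F t * \<rho> t) integrable_on {l..r}" "(\<lambda>t. c * \<rho> t) integrable_on {l..r}"
    "(\<lambda>t. e * \<rho> t) integrable_on {l..r}"
    using cF c\<rho> by (auto intro!: integrable_continuous_real continuous_intros)
  have "integral {l..r} (\<lambda>t. F t * \<rho> t) - c = integral {l..r} (\<lambda>t. F t * \<rho> t - c * \<rho> t)"
    using int one by (simp add: integral_diff)
  also have "norm \<dots> \<le> integral {l..r} (\<lambda>t. e * \<rho> t)"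
  proof (rule integral_norm_bound_integral)
    fix t assume t: "t \<in> {l..r}"
    show "norm (F t * \<rho> t - c * \<rho> t) \<le> e * \<rho> t"
    proof (cases "\<rho> t = 0")
      case False
      then have "\<bar>F t - c\<bar> * \<rho> t \<le> e * \<rho> t"
        using near[OF t] nn by (intro mult_right_mono) auto
      then show ?thesis using nn[of t] by (simp flip: left_diff_distrib add: abs_mult)
    qed simp
  qed (use int in \<open>auto intro: integrable_diff\<close>)
  finally show ?thesis using one by simp
qed

text \<open>Kernels of mass one whose supports shrink to the right of \<open>x\<close> converge to the point evaluation
  at \<open>x\<close>.\<close>
lemma integral_against_kernels_tendsto:
  fixes F :: "real \<Rightarrow> real" and \<rho> :: "nat \<Rightarrow> real \<Rightarrow> real"
  assumes cF: "continuous_on {l..r} F" and c\<rho>: "\<And>j. continuous_on {l..r} (\<rho> j)"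
    and nn: "\<And>j t. 0 \<le> \<rho> j t"
    and one: "\<And>j. integral {l..r} (\<rho> j) = 1"
    and supp: "\<And>j t. t \<notin> {x<..<x + \<epsilon> j} \<Longrightarrow> \<rho> j t = 0"
    and x: "x \<in> {l..r}" and \<epsilon>: "\<epsilon> \<longlonglongrightarrow> 0"
  shows "(\<lambda>j. integral {l..r} (\<lambda>t. F t * \<rho> j t)) \<longlonglongrightarrow> F x"
proof (rule LIMSEQ_I)
  fix e :: real assume e: "0 < e"
  obtain d where d: "d > 0" "\<And>t. t \<in> {l..r} \<Longrightarrow> dist t x < d \<Longrightarrow> dist (F t) (F x) < e / 2"
    using cF x e unfolding continuous_on_iff by (metis half_gt_zero)
  obtain N where N: "\<And>j. j \<ge> N \<Longrightarrow> \<bar>\<epsilon> j\<bar> < d"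
    using LIMSEQ_D[OF \<epsilon> d(1)] by auto
  have "norm (integral {l..r} (\<lambda>t. F t * \<rho> j t) - F x) < e" if "j \<ge> N" for j
  proof -
    have "\<bar>integral {l..r} (\<lambda>t. F t * \<rho> j t) - F x\<bar> \<le> e / 2"
    proof (rule integral_against_kernel_near[OF cF c\<rho> nn one])
      fix t assume t: "t \<in> {l..r}" "\<rho> j t \<noteq> 0"
      then have "t \<in> {x<..<x + \<epsilon> j}" using supp by blast
      then have "dist t x < d" using N[OF that] by (auto simp: dist_real_def)
      then show "\<bar>F t - F x\<bar> \<le> e / 2" using d(2)[OF t(1)] by (simp add: dist_real_def)
    qed
    then show ?thesis using e by simp
  qed
  then show "\<exists>no. \<forall>n\<ge>no. norm (integral {l..r} (\<lambda>t. F t * \<rho> n t) - F x) < e" by blast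
qed

text \<open>The relation between the generalized derivatives of two consecutive orders.\<close>
definition weak_deriv :: "real \<Rightarrow> real \<Rightarrow> (real \<Rightarrow> real) \<Rightarrow> (real \<Rightarrow> real) \<Rightarrow> bool" where
  "weak_deriv a b F G \<longleftrightarrow>
     (\<forall>\<phi>. test_function a b \<phi> \<longrightarrow>
       (LINT x:{a..b}|lebesgue. F x * deriv \<phi> x) = - (LINT x:{a..b}|lebesgue. G x * \<phi> x))"

lemma test_function_iff_smooth:
  "test_function a b \<phi> \<longleftrightarrow>
     smooth_fun \<phi> \<and> (\<exists>c d. a < c \<and> d < b \<and> (\<forall>x. x \<notin> {c..d} \<longrightarrow> \<phi> x = 0))"
  by (simp add: test_function_def smooth_fun_def)

lemma smooth_fun_continuous: "smooth_fun f \<Longrightarrow> continuous_on S f"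
  by (meson DERIV_isCont continuous_at_imp_continuous_on smooth_fun_DERIV_0)

text \<open>Test the weak derivative with \<open>\<phi> = \<sigma>\<^sub>x - \<sigma>\<^sub>y\<close>, the difference of a step rising on
  \<open>[x, x + \<epsilon>]\<close> and one rising on \<open>[y, y + \<epsilon>]\<close>. As \<open>\<epsilon>\<close> tends to 0, \<open>\<phi>\<close> tends to the
  indicator of \<open>[x, y]\<close> and, by dominated convergence, \<open>\<integral> G \<phi>\<close> to \<open>\<integral>\<^sub>x\<^sup>y G\<close>; the two
  kernels in \<open>\<phi>'\<close> turn \<open>\<integral> F \<phi>'\<close> into \<open>F x - F y\<close>.\<close>
lemma weak_deriv_FTC:
  assumes cF: "continuous_on {l..r} F" and G: "set_integrable lebesgue {l..r} G"
    and wd: "weak_deriv l r F G"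
    and xy: "l < x" "x \<le> y" "y < r"
  shows "F y - F x = (LINT t:{x..y}|lebesgue. G t)"
proof -
  \<comment> \<open>Half the distance to the right end keeps the support of every test function inside the interval.\<close>
  define \<epsilon> where "\<epsilon> j = (r - y) / 2 * inverse (real (Suc j))" for j
  have \<epsilon>: "\<epsilon> j > 0" "y + \<epsilon> j < r" for j
  proof -
    show "\<epsilon> j > 0" using xy by (simp add: \<epsilon>_def)
    have "\<epsilon> j \<le> (r - y) / 2 * 1"
      unfolding \<epsilon>_def using xy by (intro mult_left_mono) (auto simp: field_simps)
    then show "y + \<epsilon> j < r" using xy by (simp add: field_simps)
  qed
  have \<epsilon>0: "\<epsilon> \<longlonglongrightarrow> 0"
    unfolding \<epsilon>_def using tendsto_mult_right_zero[OF LIMSEQ_inverse_real_of_nat] .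
  have "\<exists>\<sigma> \<rho>. smooth_fun \<sigma> \<and> continuous_on UNIV \<rho> \<and> (\<forall>t. (\<sigma> has_real_derivative \<rho> t) (at t)) \<and>
     (\<forall>t. 0 \<le> \<rho> t) \<and> (\<forall>t. t \<notin> {z<..<z + \<epsilon> j} \<longrightarrow> \<rho> t = 0) \<and> (\<forall>t\<le>z. \<sigma> t = 0) \<and> (\<forall>t\<ge>z + \<epsilon> j. \<sigma> t = 1) \<and>
     (\<forall>t. 0 \<le> \<sigma> t) \<and> (\<forall>t. \<sigma> t \<le> 1)" for z j
    using smooth_step_exists[of z "z + \<epsilon> j"] \<epsilon>(1)[of j] by (metis less_add_same_cancel1)
  then obtain \<sigma> \<rho> where \<sigma>\<rho>: "\<And>z j. smooth_fun (\<sigma> z j)" "\<And>z j. continuous_on UNIV (\<rho> z j)"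
    "\<And>z j t. (\<sigma> z j has_real_derivative \<rho> z j t) (at t)" "\<And>z j t. 0 \<le> \<rho> z j t"
    "\<And>z j t. t \<notin> {z<..<z + \<epsilon> j} \<Longrightarrow> \<rho> z j t = 0" "\<And>z j t. t \<le> z \<Longrightarrow> \<sigma> z j t = 0"
    "\<And>z j t. z + \<epsilon> j \<le> t \<Longrightarrow> \<sigma> z j t = 1" "\<And>z j t. 0 \<le> \<sigma> z j t" "\<And>z j t. \<sigma> z j t \<le> 1"
    by metis
  define \<phi> where "\<phi> j t = \<sigma> x j t - \<sigma> y j t" for j t
  have sm: "smooth_fun (\<phi> j)" for j
    unfolding \<phi>_def by (intro smooth_fun_diff \<sigma>\<rho>)
  have d\<phi>: "deriv (\<phi> j) t = \<rho> x j t - \<rho> y j t" for j t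
    unfolding \<phi>_def by (intro DERIV_imp_deriv derivative_intros \<sigma>\<rho>)
  have \<phi>0: "\<phi> j t = 0" if "t \<notin> {x..y + \<epsilon> j}" for j t
    using that xy \<sigma>\<rho>(6,7) by (auto simp: \<phi>_def not_le)
  have "test_function l r (\<phi> j)" for j
    unfolding test_function_iff_smooth using sm \<phi>0 xy(1) \<epsilon>(2)[of j] by blast
  then have wdj: "(LINT t:{l..r}|lebesgue. F t * deriv (\<phi> j) t) = - (LINT t:{l..r}|lebesgue. G t * \<phi> j t)" for j
    using wd by (simp add: weak_deriv_def)

  have lim_kernel: "(\<lambda>j. integral {l..r} (\<lambda>t. F t * \<rho> z j t)) \<longlonglongrightarrow> F z" if z: "l < z" "z \<le> y" for z
  proof (rule integral_against_kernels_tendsto[OF cF _ _ _ \<sigma>\<rho>(5) _ \<epsilon>0])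
    show "integral {l..r} (\<rho> z j) = 1" for j
    proof -
      have "(\<rho> z j has_integral (\<sigma> z j r - \<sigma> z j l)) {l..r}"
        using xy \<sigma>\<rho>(3) by (intro fundamental_theorem_of_calculus)
          (auto simp: has_real_derivative_iff_has_vector_derivative[symmetric]
            intro: has_field_derivative_at_within)
      moreover have "\<sigma> z j r = 1" "\<sigma> z j l = 0"
        using z \<epsilon>(2)[of j] by (auto intro!: \<sigma>\<rho>)
      ultimately show ?thesis by (simp add: integral_unique)
    qed
    show "continuous_on {l..r} (\<rho> z j)" for j
      by (rule continuous_on_subset[OF \<sigma>\<rho>(2)]) simp
    show "0 \<le> \<rho> z j t" for j t by (rule \<sigma>\<rho>(4))
    show "z \<in> {l..r}" using z xy by simp
  qed
  have eqF: "(LINT t:{l..r}|lebesgue. F t * deriv (\<phi> j) t) =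
      integral {l..r} (\<lambda>t. F t * \<rho> x j t) - integral {l..r} (\<lambda>t. F t * \<rho> y j t)" for j
  proof -
    have c: "continuous_on {l..r} (\<lambda>t. F t * \<rho> z j t)" for z
      by (intro continuous_intros cF continuous_on_subset[OF \<sigma>\<rho>(2)]) auto
    have "(LINT t:{l..r}|lebesgue. F t * deriv (\<phi> j) t) =
        (LINT t:{l..r}|lebesgue. F t * \<rho> x j t - F t * \<rho> y j t)"
      by (simp add: d\<phi> algebra_simps)
    also have "\<dots> = integral {l..r} (\<lambda>t. F t * \<rho> x j t - F t * \<rho> y j t)"
      by (intro set_lebesgue_integral_eq_integral absolutely_integrable_continuous_real
          continuous_intros c)
    also have "\<dots> = integral {l..r} (\<lambda>t. F t * \<rho> x j t) - integral {l..r} (\<lambda>t. F t * \<rho> y j t)"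
      by (intro integral_diff integrable_continuous_real c)
    finally show ?thesis .
  qed
  have limF: "(\<lambda>j. LINT t:{l..r}|lebesgue. F t * deriv (\<phi> j) t) \<longlonglongrightarrow> F x - F y"
    unfolding eqF using xy by (intro tendsto_diff lim_kernel) auto

  have limG: "(\<lambda>j. LINT t:{l..r}|lebesgue. G t * \<phi> j t) \<longlonglongrightarrow> (LINT t:{x..y}|lebesgue. G t)"
    unfolding set_lebesgue_integral_def
  proof (rule integral_dominated_convergence[where w = "\<lambda>t. norm (indicator {l..r} t *\<^sub>R G t)"])
    have mG: "(\<lambda>t. indicator {l..r} t *\<^sub>R G t) \<in> borel_measurable lebesgue"
      using G by (auto simp: set_integrable_def)
    show "(\<lambda>t. indicator {x..y} t *\<^sub>R G t) \<in> borel_measurable lebesgue"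
      using set_integrable_subset[OF G, of "{x..y}"] xy by (auto simp: set_integrable_def)
    show "(\<lambda>t. indicator {l..r} t *\<^sub>R (G t * \<phi> j t)) \<in> borel_measurable lebesgue" for j
    proof -
      have "\<phi> j \<in> borel_measurable borel"
        by (intro borel_measurable_continuous_onI smooth_fun_continuous sm)
      then have "\<phi> j \<in> borel_measurable lborel" by simp
      then have "\<phi> j \<in> borel_measurable lebesgue" by (rule measurable_completion)
      from borel_measurable_times[OF mG this] show ?thesis by (simp add: mult.assoc)
    qed
    show "integrable lebesgue (\<lambda>t. norm (indicator {l..r} t *\<^sub>R G t))"
      using G unfolding set_integrable_def by (rule integrable_norm)
    show "AE t in lebesgue. norm (indicator {l..r} t *\<^sub>R (G t * \<phi> j t)) \<le> norm (indicator {l..r} t *\<^sub>R G t)" for j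
    proof (rule AE_I2)
      fix t
      have "\<bar>\<phi> j t\<bar> \<le> 1" using \<sigma>\<rho>(8,9)[of x j t] \<sigma>\<rho>(8,9)[of y j t] by (auto simp: \<phi>_def)
      then show "norm (indicator {l..r} t *\<^sub>R (G t * \<phi> j t)) \<le> norm (indicator {l..r} t *\<^sub>R G t)"
        by (auto simp: indicator_def abs_mult mult_left_le)
    qed
    show "AE t in lebesgue. (\<lambda>j. indicator {l..r} t *\<^sub>R (G t * \<phi> j t)) \<longlonglongrightarrow> indicator {x..y} t *\<^sub>R G t"
    proof -
      have lim1: "(\<lambda>j. \<sigma> z j t) \<longlonglongrightarrow> (if z < t then 1 else 0)" for z t
      proof (cases "z < t")
        case True
        then have "\<forall>\<^sub>F j in sequentially. \<epsilon> j < t - z"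
          using \<epsilon>0 by (intro order_tendstoD) auto
        then have "\<forall>\<^sub>F j in sequentially. \<sigma> z j t = 1"
          by eventually_elim (use \<sigma>\<rho>(7) in auto)
        then show ?thesis using True by (simp add: tendsto_eventually)
      qed (use \<sigma>\<rho>(6) in auto)
      have "AE t in lebesgue. t \<noteq> x"
        by (rule AE_I[where N = "{x}"]) auto
      then show ?thesis
      proof eventually_elim
        fix t assume t: "t \<noteq> x"
        have "(\<lambda>j. \<phi> j t) \<longlonglongrightarrow> (if x < t then 1 else 0) - (if y < t then 1 else 0)"
          unfolding \<phi>_def by (intro tendsto_diff lim1)
        also have "(if x < t then 1 else 0) - (if y < t then 1 else 0) = (indicator {x..y} t :: real)"
          using t xy by (auto simp: indicator_def)
        finally have "(\<lambda>j. indicator {l..r} t *\<^sub>R (G t * \<phi> j t)) \<longlonglongrightarrow>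
            indicator {l..r} t *\<^sub>R (G t * indicator {x..y} t)"
          by (intro tendsto_intros)
        then show "(\<lambda>j. indicator {l..r} t *\<^sub>R (G t * \<phi> j t)) \<longlonglongrightarrow> indicator {x..y} t *\<^sub>R G t"
          using xy by (auto simp: indicator_def)
      qed
    qed
  qed
  have "F x - F y = - (LINT t:{x..y}|lebesgue. G t)"
    using LIMSEQ_unique[OF limF] tendsto_minus[OF limG] by (simp add: wdj)
  then show ?thesis by simp
qed

lemma test_function_deriv:
  assumes "test_function a b \<phi>"
  shows "test_function a b (deriv \<phi>)"
proof -
  obtain c d where cd: "a < c" "d < b" "\<And>x. x \<notin> {c..d} \<Longrightarrow> \<phi> x = 0"
    using assms by (auto simp: test_function_def)
  have "deriv \<phi> x = 0" if "x \<notin> {c..d}" for x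
  proof (rule DERIV_imp_deriv)
    show "(\<phi> has_real_derivative 0) (at x)"
      by (rule has_field_derivative_transform_within_open[where f = "\<lambda>_. 0" and S = "- {c..d}"])
         (use that cd in auto)
  qed
  then show ?thesis
    using assms cd(1,2) smooth_fun_deriv unfolding test_function_iff_smooth by blast
qed

text \<open>Using \<open>\<phi>'\<close> as the test function in the identity of order \<open>i\<close> and \<open>\<phi>\<close> in the one of order
  \<open>i + 1\<close> gives two expressions for the same integral of \<open>f\<close>.\<close>
lemma has_gderiv_weak_deriv:
  assumes "has_gderiv a b i f g" "has_gderiv a b (Suc i) f h"
  shows "weak_deriv a b g h"
  unfolding weak_deriv_def
proof (intro allI impI)
  fix \<phi> assume \<phi>: "test_function a b \<phi>"
  have "(-1) ^ i * (LINT x:{a..b}|lebesgue. g x * deriv \<phi> x) =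
      (LINT x:{a..b}|lebesgue. f x * (deriv ^^ i) (deriv \<phi>) x)"
    using assms(1) test_function_deriv[OF \<phi>] by (simp add: has_gderiv_def)
  also have "\<dots> = (-1) ^ Suc i * (LINT x:{a..b}|lebesgue. h x * \<phi> x)"
    using assms(2) \<phi> by (simp add: has_gderiv_def funpow_swap1)
  finally show "(LINT x:{a..b}|lebesgue. g x * deriv \<phi> x) = - (LINT x:{a..b}|lebesgue. h x * \<phi> x)"
    by (cases "even i") auto
qed

text \<open>By the fundamental theorem \<open>F\<close> is locally a primitive of the continuous function \<open>G\<close>.\<close>
lemma weak_deriv_DERIV:
  assumes cF: "continuous_on {a..b} F" and cG: "continuous_on {a..b} G"
    and wd: "weak_deriv a b F G" and x: "a < x" "x < b"
  shows "(F has_real_derivative G x) (at x)"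
proof -
  define l r where "l = (a + x) / 2" and "r = (x + b) / 2"
  have lr: "a < l" "l < x" "x < r" "r < b" using x by (auto simp: l_def r_def field_simps)
  have cG': "continuous_on {l..r} G"
    by (rule continuous_on_subset[OF cG]) (use lr in auto)
  have FTC: "F y = F l + integral {l..y} G" if "y \<in> {l<..<r}" for y
  proof -
    have "F y - F l = (LINT t:{l..y}|lebesgue. G t)"
      using that lr by (intro weak_deriv_FTC[OF cF _ wd] absolutely_integrable_continuous_real cG) auto
    also have "\<dots> = integral {l..y} G"
      by (intro set_lebesgue_integral_eq_integral absolutely_integrable_continuous_real
          continuous_on_subset[OF cG]) (use that lr in auto)
    finally show ?thesis by simp
  qed
  have "((\<lambda>u. integral {l..u} G) has_real_derivative G x) (at x within {l..r})"
    using lr by (intro integral_has_real_derivative cG') auto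
  then have "((\<lambda>u. integral {l..u} G) has_real_derivative G x) (at x)"
    using lr by (subst (asm) at_within_interior) auto
  then have "((\<lambda>u. F l + integral {l..u} G) has_real_derivative G x) (at x)"
    by (auto intro!: derivative_eq_intros)
  then show ?thesis
    by (rule has_field_derivative_transform_within_open[where S = "{l<..<r}"])
       (use lr FTC in auto)
qed

text \<open>The fundamental theorem covers interior points only; the boundary points follow by continuity of
  \<open>F\<close>, moving one argument at a time. The boundary matters, because that is where zeros are
  prescribed.\<close>
lemma weak_deriv_diff_le:
  assumes cF: "continuous_on {a..b} F" and G: "set_integrable lebesgue {a..b} G"
    and wd: "weak_deriv a b F G" and xy: "x \<in> {a..b}" "y \<in> {a..b}" and "a < b"
  shows "\<bar>F y - F x\<bar> \<le> (LINT t:{a..b}|lebesgue. \<bar>G t\<bar>)"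
proof -
  define I where "I = (LINT t:{a..b}|lebesgue. \<bar>G t\<bar>)"
  have le: "\<bar>F y - F x\<bar> \<le> I" if "a < x" "x \<le> y" "y < b" for x y
  proof -
    have sub: "set_integrable lebesgue {x..y} G"
      by (rule set_integrable_subset[OF G]) (use that in auto)
    have "\<bar>F y - F x\<bar> \<le> (LINT t:{x..y}|lebesgue. \<bar>G t\<bar>)"
      unfolding weak_deriv_FTC[OF cF G wd that] using set_integral_norm_bound[OF sub] by simp
    also have "\<dots> \<le> I"
      unfolding I_def set_lebesgue_integral_def
      using set_integrable_abs[OF sub] set_integrable_abs[OF G] that
      by (intro integral_mono) (auto simp: set_integrable_def indicator_def)
    finally show ?thesis .
  qed
  have le': "\<bar>F y - F x\<bar> \<le> I" if "x \<in> {a<..<b}" "y \<in> {a<..<b}" for x y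
    using le[of x y] le[of y x] that by (cases "x \<le> y") (auto simp: abs_minus_commute)
  have cl: "closure {a<..<b} = {a..b}" using \<open>a < b\<close> by simp
  have le'': "\<bar>F y - F x\<bar> \<le> I" if "x \<in> {a<..<b}" "y \<in> {a..b}" for x y
    by (rule continuous_le_on_closure[where S = "{a<..<b}" and f = "\<lambda>y. \<bar>F y - F x\<bar>"])
       (use cl that le' in \<open>auto intro!: continuous_intros cF\<close>)
  have "\<bar>F y - F x\<bar> \<le> I"
    by (rule continuous_le_on_closure[where S = "{a<..<b}" and f = "\<lambda>x. \<bar>F y - F x\<bar>"])
       (use cl xy le'' in \<open>auto intro!: continuous_intros cF\<close>)
  then show ?thesis by (simp add: I_def)
qed

section \<open>Zeros forced by the boundary conditions\<close>
text \<open>Induction removes the largest zero, which is why the new zeros are kept below \<open>Max Z\<close>: Rolle's theorem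
  between the two largest zeros then yields a zero to the right of all those already found.\<close>
lemma Rolle_finite_zeros:
  fixes f :: "real \<Rightarrow> real"
  assumes cont: "continuous_on {a..b} f"
    and der: "\<And>x. a < x \<Longrightarrow> x < b \<Longrightarrow> (f has_real_derivative f' x) (at x)"
    and "finite Z" "Z \<subseteq> {a..b}" "\<And>z. z \<in> Z \<Longrightarrow> f z = 0" "card Z = Suc m"
  shows "\<exists>Z'. finite Z' \<and> Z' \<subseteq> {a<..<Max Z} \<and> card Z' = m \<and> (\<forall>z\<in>Z'. f' z = 0)"
  using assms(3-)
proof (induction m arbitrary: Z)
  case 0
  show ?case by (rule exI[of _ "{}"]) auto
next
  case (Suc m)
  define M Y where "M = Max Z" and "Y = Z - {M}"
  have ne: "Z \<noteq> {}" using Suc.prems by auto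
  have M: "M \<in> Z" unfolding M_def using Suc.prems ne by (intro Max_in) auto
  have cY: "card Y = Suc m" using Suc.prems M by (simp add: Y_def)
  then have neY: "Y \<noteq> {}" by auto
  have fY: "finite Y" "Y \<subseteq> Z" using Suc.prems by (auto simp: Y_def)
  have MY: "Max Y \<in> Y" using fY neY by (intro Max_in) auto
  have "Max Y \<le> M" unfolding M_def using Suc.prems fY MY by (intro Max_ge) auto
  moreover have "Max Y \<noteq> M" using MY by (auto simp: Y_def)
  ultimately have lt: "Max Y < M" by simp
  obtain Y' where Y': "finite Y'" "Y' \<subseteq> {a<..<Max Y}" "card Y' = m" "\<forall>z\<in>Y'. f' z = 0"
    using Suc.IH[OF fY(1) _ _ cY] fY(2) Suc.prems(2,3) by (auto simp: subset_iff)
  have ab: "a \<le> Max Y" "M \<le> b" using Suc.prems MY M fY by auto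
  have "continuous_on {Max Y..M} f"
    by (rule continuous_on_subset[OF cont]) (use ab in auto)
  moreover have "f (Max Y) = f M" using Suc.prems M MY fY by auto
  moreover have "(f has_derivative (*) (f' x)) (at x)" if "Max Y < x" "x < M" for x
    using der[of x] that ab by (simp add: has_field_derivative_def)
  ultimately have "\<exists>z. Max Y < z \<and> z < M \<and> (*) (f' z) = (\<lambda>_. 0)"
    by (intro Rolle_deriv[OF lt, of f "\<lambda>x. (*) (f' x)"])
  then obtain z where z: "Max Y < z" "z < M" "(*) (f' z) = (\<lambda>_. 0)"
    by (elim exE conjE)
  have fz: "f' z = 0" using fun_cong[OF z(3), of 1] by simp
  show ?case
  proof (intro exI[of _ "insert z Y'"] conjI)
    show "card (insert z Y') = Suc m" using Y'(1-3) z(1,2) by (subst card_insert_disjoint) auto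
    show "insert z Y' \<subseteq> {a<..<Max Z}"
      unfolding M_def[symmetric] using Y'(2) z(1,2) ab lt by auto
  qed (use Y'(1,4) fz in auto)
qed

text \<open>A count with multiplicity: the \<open>i\<close>-th derivative has interior zeros \<open>S\<close>, a zero of multiplicity
  \<open>k - i\<close> at 0 and one of multiplicity \<open>n - k - i\<close> at 1 (truncated subtraction), at least \<open>n - i\<close> in
  all. Rolle's theorem turns the \<open>m + 1\<close> distinct zeros into \<open>m\<close> interior zeros of the next derivative,
  while each multiplicity that is still positive drops by one, so that the total decreases by
  exactly one.\<close>
lemma boundary_zeros_count:
  fixes D :: "nat \<Rightarrow> real \<Rightarrow> real"
  assumes cont: "\<And>i. i < n \<Longrightarrow> continuous_on {0..1} (D i)"
    and der: "\<And>i x. Suc i < n \<Longrightarrow> 0 < x \<Longrightarrow> x < 1 \<Longrightarrow> (D i has_real_derivative D (Suc i) x) (at x)"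
    and bd0: "\<And>i. i < k \<Longrightarrow> D i 0 = 0" and bd1: "\<And>j. j < n - k \<Longrightarrow> D j 1 = 0"
    and "k \<le> n" "i < n"
  shows "\<exists>S. finite S \<and> S \<subseteq> {0<..<1} \<and> (\<forall>z\<in>S. D i z = 0) \<and> n - i \<le> card S + (k - i) + (n - k - i)"
  using \<open>i < n\<close>
proof (induction i)
  case 0
  then show ?case using \<open>k \<le> n\<close> by (intro exI[of _ "{}"]) auto
next
  case (Suc i)
  then obtain S where S: "finite S" "S \<subseteq> {0<..<1}" "\<forall>z\<in>S. D i z = 0"
    "n - i \<le> card S + (k - i) + (n - k - i)" by auto
  define Z where "Z = S \<union> (if i < k then {0} else {}) \<union> (if i < n - k then {1} else {})"
  have cZ: "card Z = card S + (if i < k then 1 else 0) + (if i < n - k then 1 else 0)"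
  proof -
    have "0 \<notin> S" "1 \<notin> S" using S by auto
    then show ?thesis using S(1) by (auto simp: Z_def)
  qed
  then have "card Z > 0" using S(4) Suc.prems by (cases "i < k"; cases "i < n - k") simp_all
  then obtain m where m: "card Z = Suc m" using gr0_implies_Suc by blast
  have Z: "finite Z" "Z \<subseteq> {0..1}" "\<And>z. z \<in> Z \<Longrightarrow> D i z = 0"
    using S bd0[of i] bd1[of i] by (auto simp: Z_def split: if_splits)
  have "Max Z \<in> Z" using Z m by (intro Max_in) auto
  then have "Max Z \<le> 1" using Z(2) by auto
  have "continuous_on {0..1} (D i)" using cont Suc.prems by simp
  from Rolle_finite_zeros[OF this der Z m] obtain Z' where
    "finite Z'" "Z' \<subseteq> {0<..<Max Z}" "card Z' = m" "\<forall>z\<in>Z'. D (Suc i) z = 0"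
    using Suc.prems by blast
  moreover have "n - Suc i \<le> m + (k - Suc i) + (n - k - Suc i)"
    using cZ m S(4) Suc.prems by (cases "i < k"; cases "i < n - k"; simp; arith)
  ultimately show ?case
    using \<open>Max Z \<le> 1\<close> by (intro exI[of _ Z']) auto
qed

text \<open>Since the count stays positive, every derivative of order below \<open>n\<close> vanishes somewhere on \<open>[0, 1]\<close>.
  The oscillation bound for the order \<open>n - 1\<close> is therefore a bound for its absolute value, and the mean value
  theorem carries it down to order 0, because the interval has length 1.\<close>
lemma boundary_zeros_bound:
  fixes D :: "nat \<Rightarrow> real \<Rightarrow> real"
  assumes cont: "\<And>i. i < n \<Longrightarrow> continuous_on {0..1} (D i)"
    and der: "\<And>i x. Suc i < n \<Longrightarrow> 0 < x \<Longrightarrow> x < 1 \<Longrightarrow> (D i has_real_derivative D (Suc i) x) (at x)"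
    and bd0: "\<And>i. i < k \<Longrightarrow> D i 0 = 0" and bd1: "\<And>j. j < n - k \<Longrightarrow> D j 1 = 0"
    and "k \<le> n" "0 < n"
    and osc: "\<And>x y. x \<in> {0..1} \<Longrightarrow> y \<in> {0..1} \<Longrightarrow> \<bar>D (n - 1) y - D (n - 1) x\<bar> \<le> I"
    and x: "x \<in> {0..1}"
  shows "\<bar>D 0 x\<bar> \<le> I"
proof -
  have zero: "\<exists>z\<in>{0..1}. D i z = 0" if i: "i < n" for i
  proof -
    obtain S where S: "finite S" "S \<subseteq> {0<..<1}" "\<forall>z\<in>S. D i z = 0"
      "n - i \<le> card S + (k - i) + (n - k - i)"
      using boundary_zeros_count[where D = D and i = i, OF cont der bd0 bd1 \<open>k \<le> n\<close> i] by auto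
    have "i < k \<or> i < n - k \<or> S \<noteq> {}"
    proof (rule ccontr)
      assume "\<not> ?thesis"
      then have "k \<le> i" "n - k \<le> i" "card S = 0" by auto
      then show False using S(4) i by arith
    qed
    then consider "i < k" | "i < n - k" | "S \<noteq> {}" by blast
    then show ?thesis
    proof cases
      case 1 then show ?thesis using bd0 by (intro bexI[of _ 0]) auto
    next
      case 2 then show ?thesis using bd1 by (intro bexI[of _ 1]) auto
    next
      case 3 then show ?thesis using S(2,3) by force
    qed
  qed
  have "\<forall>x\<in>{0..1}. \<bar>D 0 x\<bar> \<le> I"
  proof -
    have "0 \<le> n - 1" by simp
    then show ?thesis
    proof (induction rule: inc_induct)
      case base
      show ?case
      proof
        fix x :: real assume "x \<in> {0..1}"
        obtain z where z: "z \<in> {0..1}" "D (n - 1) z = 0" using zero[of "n - 1"] \<open>0 < n\<close> by auto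
        then show "\<bar>D (n - 1) x\<bar> \<le> I" using osc[OF z(1) \<open>x \<in> {0..1}\<close>] by simp
      qed
    next
      case (step i)
      have i: "Suc i < n" using step.hyps by auto
      show ?case
      proof
        fix x :: real assume x: "x \<in> {0..1}"
        obtain z where z: "z \<in> {0..1}" "D i z = 0" using zero[of i] i by auto
        have lip: "\<bar>D i v - D i u\<bar> \<le> I" if uv: "0 \<le> u" "u < v" "v \<le> 1" for u v
        proof -
          have "continuous_on {u..v} (D i)"
            by (rule continuous_on_subset[OF cont]) (use uv i in auto)
          moreover have "(D i has_derivative (*) (D (Suc i) w)) (at w)" if "u < w" "w < v" for w
            using der[OF i, of w] that uv by (simp add: has_field_derivative_def)
          ultimately obtain w where w: "u < w" "w < v" "D i v - D i u = D (Suc i) w * (v - u)"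
            using mvt[OF uv(2), of "D i" "\<lambda>w. (*) (D (Suc i) w)"] by blast
          then have "\<bar>D i v - D i u\<bar> = (v - u) * \<bar>D (Suc i) w\<bar>" using w uv by (simp add: abs_mult)
          also have "\<dots> \<le> 1 * \<bar>D (Suc i) w\<bar>" using uv by (intro mult_right_mono) auto
          also have "\<dots> \<le> I" using step.IH w uv by auto
          finally show ?thesis .
        qed
        have "0 \<le> I" using step.IH by (meson abs_ge_zero order_trans x)
        consider "x < z" | "x = z" | "z < x" by linarith
        then show "\<bar>D i x\<bar> \<le> I"
          by cases (use lip[of x z] lip[of z x] x z \<open>0 \<le> I\<close> in auto)
      qed
    qed
  qed
  then show ?thesis using x by blast
qed

section \<open>Dilations of generalized derivatives\<close>
lemma set_integrable_rescale:
  fixes h :: "real \<Rightarrow> real"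
  assumes "c > 0" "set_integrable lebesgue {0..b} h"
  shows "set_integrable lebesgue {0..b / c} (\<lambda>t. h (c * t))"
proof -
  have "integrable lebesgue (\<lambda>t. indicator {0..b} (0 + c * t) *\<^sub>R h (0 + c * t))"
    using assms lebesgue_integrable_real_affine[of "\<lambda>t. indicator {0..b} t *\<^sub>R h t" c 0]
    by (simp add: set_integrable_def)
  moreover have "indicator {0..b} (0 + c * t) = (indicator {0..b / c} t :: real)" for t
    using assms(1) by (auto simp: indicator_def pos_le_divide_eq zero_le_mult_iff mult.commute)
  ultimately show ?thesis by (simp add: set_integrable_def)
qed

lemma set_integral_rescale:
  fixes h :: "real \<Rightarrow> real"
  assumes "c > 0"
  shows "(LINT t:{0..b / c}|lebesgue. h (c * t)) = (LINT x:{0..b}|lebesgue. h x) / c"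
proof -
  have "indicator {0..b} (c * t) = (indicator {0..b / c} t :: real)" for t
    using assms by (auto simp: indicator_def pos_le_divide_eq zero_le_mult_iff mult.commute)
  then have "(LINT x:{0..b}|lebesgue. h x) = c * (LINT t:{0..b / c}|lebesgue. h (c * t))"
    using assms lebesgue_integral_real_affine[of c "\<lambda>t. indicator {0..b} t *\<^sub>R h t" 0]
    by (simp add: set_lebesgue_integral_def)
  then show ?thesis using assms by simp
qed

text \<open>Change of variables, with the test function \<open>\<phi>\<close> on \<open>(0, b / c)\<close> replaced by \<open>\<phi> (x / c)\<close> on \<open>(0, b)\<close>.\<close>
lemma has_gderiv_rescale:
  assumes c: "c > 0" and F: "has_gderiv 0 b n F g"
  shows "has_gderiv 0 (b / c) n (\<lambda>t. F (c * t)) (\<lambda>t. c ^ n * g (c * t))"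
  unfolding has_gderiv_def
proof (intro conjI allI impI)
  show "set_integrable lebesgue {0..b / c} (\<lambda>t. F (c * t))"
    using set_integrable_rescale[OF c] F by (simp add: has_gderiv_def)
  show "set_integrable lebesgue {0..b / c} (\<lambda>t. c ^ n * g (c * t))"
    using set_integrable_rescale[OF c] F by (intro set_integrable_mult_right) (simp add: has_gderiv_def)
  fix \<phi> assume \<phi>: "test_function 0 (b / c) \<phi>"
  define \<psi> where "\<psi> x = \<phi> (1 / c * x)" for x
  have sm: "smooth_fun \<phi>" using \<phi> by (simp add: test_function_iff_smooth)
  obtain u v where uv: "0 < u" "v < b / c" "\<And>x. x \<notin> {u..v} \<Longrightarrow> \<phi> x = 0"
    using \<phi> by (auto simp: test_function_def)
  have "test_function 0 b \<psi>"
    unfolding test_function_iff_smooth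
  proof
    show "smooth_fun \<psi>" unfolding \<psi>_def by (rule smooth_fun_rescale[OF sm])
    have "\<psi> x = 0" if "x \<notin> {c * u..c * v}" for x
      unfolding \<psi>_def using that c by (intro uv) (auto simp: field_simps)
    moreover have "0 < c * u" "c * v < b" using c uv by (auto simp: field_simps)
    ultimately show "\<exists>u' v'. 0 < u' \<and> v' < b \<and> (\<forall>x. x \<notin> {u'..v'} \<longrightarrow> \<psi> x = 0)" by blast
  qed
  then have eq: "(LINT x:{0..b}|lebesgue. F x * (deriv ^^ n) \<psi> x) =
      (-1) ^ n * (LINT x:{0..b}|lebesgue. g x * \<psi> x)"
    using F by (simp add: has_gderiv_def)
  have d: "(deriv ^^ n) \<psi> = (\<lambda>x. (1 / c) ^ n * (deriv ^^ n) \<phi> (1 / c * x))"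
    unfolding \<psi>_def by (rule higher_deriv_rescale[OF sm])
  have "(LINT t:{0..b / c}|lebesgue. F (c * t) * (deriv ^^ n) \<phi> t) =
      (LINT t:{0..b / c}|lebesgue. c ^ n * (F (c * t) * (deriv ^^ n) \<psi> (c * t)))"
    using c by (simp add: d power_one_over)
  also have "\<dots> = c ^ n * ((LINT x:{0..b}|lebesgue. F x * (deriv ^^ n) \<psi> x) / c)"
    using set_integral_rescale[OF c, of b "\<lambda>x. F x * (deriv ^^ n) \<psi> x"] by simp
  also have "\<dots> = (-1) ^ n * (c ^ n * (LINT t:{0..b / c}|lebesgue. g (c * t) * \<psi> (c * t)))"
    using set_integral_rescale[OF c, of b "\<lambda>x. g x * \<psi> x"] by (simp add: eq)
  also have "\<dots> = (-1) ^ n * (LINT t:{0..b / c}|lebesgue. c ^ n * g (c * t) * \<phi> t)"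
    using c by (simp add: \<psi>_def mult.assoc)
  finally show "(LINT t:{0..b / c}|lebesgue. F (c * t) * (deriv ^^ n) \<phi> t) =
      (-1) ^ n * (LINT t:{0..b / c}|lebesgue. c ^ n * g (c * t) * \<phi> t)" .
qed

lemma has_gderiv_cong:
  assumes "\<And>x. x \<in> {a..b} \<Longrightarrow> f x = f' x"
  shows "has_gderiv a b n f g = has_gderiv a b n f' g"
proof -
  have "(LINT x:{a..b}|lebesgue. f x * h x) = (LINT x:{a..b}|lebesgue. f' x * h x)" for h
    using assms by (intro set_lebesgue_integral_cong) auto
  moreover have "set_integrable lebesgue {a..b} f = set_integrable lebesgue {a..b} f'"
    using assms by (intro set_integrable_cong) auto
  ultimately show ?thesis by (simp add: has_gderiv_def)
qed

text \<open>The dilated function has a generalized derivative, obtained by rescaling that of \<open>f\<close>, so \<open>g\<close> is one.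
  Rescaling back shows that \<open>\<Delta> ^ n * g (\<Delta> t)\<close> is an \<open>n\<close>-th generalized derivative of \<open>f\<close>,
  and the integral of its absolute value over \<open>[0, 1]\<close> is the right hand side. The argument applies to whichever representative
  \<open>gderiv\<close> chooses.\<close>
lemma Z_class_sup_bound:
  assumes f: "f \<in> Z_class n k" and k: "k < n" and \<Delta>: "\<Delta> > 0" and x: "x \<in> {0..1}"
  defines "g \<equiv> gderiv 0 \<Delta> n (dilation \<Delta> f)"
  shows "set_integrable lebesgue {0..\<Delta>} g"
    and "\<bar>f x\<bar> \<le> \<Delta> ^ n * ((LINT x:{0..\<Delta>}|lebesgue. \<bar>g x\<bar>) / \<Delta>)"
proof -
  obtain D where D: "\<forall>x\<in>{0..1}. D 0 x = f x" "\<forall>i\<le>n. has_gderiv 0 1 i f (D i)"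
    "\<forall>i<n. continuous_on {0..1} (D i)" "\<forall>i<k. D i 0 = 0" "\<forall>j<n - k. D j 1 = 0"
    using f by (auto simp: Z_class_def)
  have "has_gderiv 0 \<Delta> n (\<lambda>x. f (1 / \<Delta> * x)) (\<lambda>x. (1 / \<Delta>) ^ n * D n (1 / \<Delta> * x))"
    using has_gderiv_rescale[of "1 / \<Delta>" 1 n f "D n"] D(2) \<Delta> by simp
  then have "has_gderiv 0 \<Delta> n (dilation \<Delta> f) (\<lambda>x. (1 / \<Delta>) ^ n * D n (1 / \<Delta> * x))"
    by (rule has_gderiv_cong[THEN iffD1, rotated]) (use \<Delta> in \<open>auto simp: dilation_def\<close>)
  then have g: "has_gderiv 0 \<Delta> n (dilation \<Delta> f) g"
    unfolding g_def gderiv_def by (rule someI[where P = "has_gderiv 0 \<Delta> n (dilation \<Delta> f)"])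
  then show "set_integrable lebesgue {0..\<Delta>} g" by (simp add: has_gderiv_def)
  define G where "G = (\<lambda>t. \<Delta> ^ n * g (\<Delta> * t))"
  have "has_gderiv 0 1 n (\<lambda>t. dilation \<Delta> f (\<Delta> * t)) G"
    using has_gderiv_rescale[OF \<Delta> g] \<Delta> by (simp add: G_def)
  then have G: "has_gderiv 0 1 n f G"
    by (rule has_gderiv_cong[THEN iffD1, rotated]) (use \<Delta> in \<open>auto simp: dilation_def\<close>)
  have "weak_deriv 0 1 (D i) (D (Suc i))" if "Suc i < n" for i
    using D(2) that by (intro has_gderiv_weak_deriv[of _ _ i f]) auto
  then have der: "(D i has_real_derivative D (Suc i) x) (at x)" if "Suc i < n" "0 < x" "x < 1" for i x
    using that D(3) by (intro weak_deriv_DERIV[of 0 1]) auto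
  have wdG: "weak_deriv 0 1 (D (n - 1)) G"
    using D(2) G k by (intro has_gderiv_weak_deriv[of _ _ "n - 1" f]) auto
  have osc: "\<bar>D (n - 1) y - D (n - 1) x\<bar> \<le> (LINT t:{0..1}|lebesgue. \<bar>G t\<bar>)"
    if "x \<in> {0..1}" "y \<in> {0..1}" for x y
    using D(3) k G that by (intro weak_deriv_diff_le[OF _ _ wdG]) (auto simp: has_gderiv_def)
  have "\<bar>D 0 x\<bar> \<le> (LINT t:{0..1}|lebesgue. \<bar>G t\<bar>)"
    by (rule boundary_zeros_bound[of n D k]) (use D der osc k x in auto)
  also have "\<dots> = \<Delta> ^ n * (LINT t:{0..\<Delta> / \<Delta>}|lebesgue. \<bar>g (\<Delta> * t)\<bar>)"
    using \<Delta> by (simp add: G_def abs_mult)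
  also have "\<dots> = \<Delta> ^ n * ((LINT x:{0..\<Delta>}|lebesgue. \<bar>g x\<bar>) / \<Delta>)"
    by (subst set_integral_rescale[OF \<Delta>, of \<Delta> "\<lambda>x. \<bar>g x\<bar>"]) simp
  finally show "\<bar>f x\<bar> \<le> \<Delta> ^ n * ((LINT x:{0..\<Delta>}|lebesgue. \<bar>g x\<bar>) / \<Delta>)"
    using D(1) x by simp
qed

section \<open>Orlicz norms and the Zygmund functions\<close>
text \<open>Monotonicity of \<open>\<Phi> u / u\<close> takes the place of convexity. It costs a factor 2 in Jensen's inequality
  and is much easier to check for the Zygmund functions.\<close>
definition orlicz_like :: "(real \<Rightarrow> real) \<Rightarrow> bool" where
  "orlicz_like \<Phi> \<longleftrightarrow>
     (\<forall>u. \<Phi> \<bar>u\<bar> = \<Phi> u) \<and> \<Phi> 0 = 0 \<and> (\<forall>u>0. 0 < \<Phi> u) \<and>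
     (\<forall>s u. 0 < s \<longrightarrow> s \<le> u \<longrightarrow> \<Phi> s / s \<le> \<Phi> u / u)"

lemma orlicz_like_nonneg: "orlicz_like \<Phi> \<Longrightarrow> 0 \<le> \<Phi> u"
  unfolding orlicz_like_def by (metis abs_ge_zero less_eq_real_def)

lemma orlicz_like_mono:
  assumes "orlicz_like \<Phi>" "\<bar>u\<bar> \<le> \<bar>v\<bar>"
  shows "\<Phi> u \<le> \<Phi> v"
proof (cases "u = 0")
  case True
  then show ?thesis using assms orlicz_like_nonneg[OF assms(1)] by (simp add: orlicz_like_def)
next
  case False
  then have uv: "0 < \<bar>u\<bar>" "0 < \<bar>v\<bar>" using assms by auto
  have "\<Phi> \<bar>u\<bar> / \<bar>u\<bar> \<le> \<Phi> \<bar>v\<bar> / \<bar>v\<bar>"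
    using assms uv unfolding orlicz_like_def by blast
  then have "\<Phi> \<bar>u\<bar> \<le> \<Phi> \<bar>v\<bar> / \<bar>v\<bar> * \<bar>u\<bar>" using uv by (simp add: divide_le_eq)
  also have "\<dots> \<le> \<Phi> \<bar>v\<bar> / \<bar>v\<bar> * \<bar>v\<bar>"
    using assms(2) orlicz_like_nonneg[OF assms(1)] by (intro mult_left_mono) auto
  finally show ?thesis using assms(1) uv by (simp add: orlicz_like_def)
qed

text \<open>A substitute for the tangent line of a convex function at \<open>s\<close>. The line through \<open>(s, 0)\<close> with slope
  \<open>\<Phi> s / s\<close> is negative on \<open>\<bar>u\<bar> < s\<close>, and for \<open>\<bar>u\<bar> \<ge> s\<close> it lies below the line
  \<open>\<Phi> s / s * \<bar>u\<bar>\<close>.\<close>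
lemma orlicz_like_linear_minorant:
  assumes \<Phi>: "orlicz_like \<Phi>" and s: "0 < s"
  shows "\<Phi> s / s * (\<bar>u\<bar> - s) \<le> \<Phi> u"
proof (cases "s \<le> \<bar>u\<bar>")
  case True
  then have "\<Phi> s / s \<le> \<Phi> \<bar>u\<bar> / \<bar>u\<bar>"
    using \<Phi> s unfolding orlicz_like_def by blast
  then have "\<Phi> s / s * (\<bar>u\<bar> - s) \<le> \<Phi> \<bar>u\<bar> / \<bar>u\<bar> * \<bar>u\<bar>"
    using True s orlicz_like_nonneg[OF \<Phi>] by (intro mult_mono) auto
  then show ?thesis using True s \<Phi> by (simp add: orlicz_like_def)
next
  case False
  have "\<Phi> s / s * (\<bar>u\<bar> - s) \<le> 0"
    using False s orlicz_like_nonneg[OF \<Phi>, of s] by (intro mult_nonneg_nonpos) auto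
  then show ?thesis using orlicz_like_nonneg[OF \<Phi>, of u] by simp
qed

text \<open>With \<open>L = u / t \<ge> 1\<close>: \<open>ln (C + L t) \<le> ln (C + t) + ln L\<close>, and \<open>ln L \<le> a ln L ln (C + t)\<close> once
  \<open>C\<close> is so large that \<open>a ln C \<ge> 1\<close>. Finally \<open>1 + a ln L \<le> L powr a\<close>.\<close>
lemma log_quasi_sublinear:
  fixes C a t u :: real
  assumes "1 < C" "0 < a" "1 \<le> a * ln C" "0 < t" "t \<le> u"
  shows "ln (C + u) \<le> (u / t) powr a * ln (C + t)"
proof -
  define L where "L = u / t"
  have L: "1 \<le> L" "u = L * t" using assms by (auto simp: L_def)
  have lnL: "0 \<le> ln L" using L by simp
  have "C + u \<le> L * (C + t)" using L assms(1) by (simp add: algebra_simps)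
  then have "ln (C + u) \<le> ln (L * (C + t))" using assms by (intro ln_mono) auto
  also have "\<dots> = ln (C + t) + ln L" using L assms by (simp add: ln_mult)
  also have "ln L \<le> a * ln C * ln L" using mult_right_mono[OF assms(3) lnL] by simp
  also have "\<dots> \<le> a * ln (C + t) * ln L"
    using assms lnL by (intro mult_right_mono mult_left_mono ln_mono) auto
  also have "ln (C + t) + \<dots> = (1 + a * ln L) * ln (C + t)" by (simp add: algebra_simps)
  also have "\<dots> \<le> L powr a * ln (C + t)"
  proof (rule mult_right_mono)
    show "1 + a * ln L \<le> L powr a"
      using exp_ge_add_one_self[of "a * ln L"] L by (simp add: powr_def)
  qed (use assms in auto)
  finally show ?thesis by (simp add: L_def)
qed

text \<open>Here \<open>\<Phi> u / u = u powr (r - 1) * ln (C + u) powr s\<close>. For negative \<open>s\<close> the decay of the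
  second factor is dominated by the growth of the first: the previous lemma with \<open>a = (r - 1) / - s\<close> bounds
  the loss by \<open>(u / t) powr (r - 1)\<close>. The condition \<open>a ln C \<ge> 1\<close> is the reason for the lower bound on
  \<open>C\<close>.\<close>
lemma orlicz_like_zygmund_fun:
  assumes r: "1 \<le> r" and s: "0 \<le> s \<or> 1 < r" and C: "exp (1 + \<bar>s\<bar> / (r - 1)) \<le> C"
  shows "orlicz_like (zygmund_fun C r s)"
  unfolding orlicz_like_def
proof (intro conjI allI impI)
  have "1 < exp (1 + \<bar>s\<bar> / (r - 1))" using r by (simp add: add_pos_nonneg)
  then have C1: "1 < C" using C by (rule less_le_trans)
  have lnC: "1 + \<bar>s\<bar> / (r - 1) \<le> ln C" using C C1 by (simp add: ln_ge_iff)
  show "zygmund_fun C r s \<bar>u\<bar> = zygmund_fun C r s u" for u by (simp add: zygmund_fun_def)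
  show "zygmund_fun C r s 0 = 0" by (simp add: zygmund_fun_def)
  show "0 < zygmund_fun C r s u" if "u > 0" for u
    using that C1 by (simp add: zygmund_fun_def)
  fix t u :: real assume tu: "0 < t" "t \<le> u"
  have quot: "zygmund_fun C r s u / u = u powr (r - 1) * ln (C + u) powr s" if "0 < u" for u
    using that by (simp add: zygmund_fun_def powr_diff)
  have ln0: "0 < ln (C + t)" "0 < ln (C + u)" using C1 tu by auto
  have "t powr (r - 1) * ln (C + t) powr s \<le> u powr (r - 1) * ln (C + u) powr s"
  proof (cases "0 \<le> s")
    case True
    then show ?thesis
      using tu r C1 ln0 by (intro mult_mono powr_mono2) auto
  next
    case False
    with s have s: "s < 0" "1 < r" by auto
    define a where "a = (r - 1) / - s"
    have a: "0 < a" unfolding a_def using s by (intro divide_pos_pos) auto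
    have "1 \<le> a * ln C"
    proof -
      have "1 = a * (\<bar>s\<bar> / (r - 1))" using s by (simp add: a_def field_simps)
      also have "\<dots> \<le> a * ln C" using a lnC by (intro mult_left_mono) auto
      finally show ?thesis .
    qed
    from log_quasi_sublinear[OF C1 a this tu]
    have "((u / t) powr a * ln (C + t)) powr s \<le> ln (C + u) powr s"
      by (rule powr_mono2'[rotated -1]) (use s ln0 in simp_all)
    moreover have "((u / t) powr a * ln (C + t)) powr s = (u / t) powr (1 - r) * ln (C + t) powr s"
    proof -
      have "a * s = 1 - r" using s by (simp add: a_def)
      then show ?thesis using tu ln0 by (simp add: powr_mult powr_powr)
    qed
    ultimately have "u powr (r - 1) * ((u / t) powr (1 - r) * ln (C + t) powr s) \<le>
        u powr (r - 1) * ln (C + u) powr s"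
      by (intro mult_left_mono) auto
    moreover have "u powr (r - 1) * (u / t) powr (1 - r) = t powr (r - 1)"
      using tu powr_minus_divide[of "u / t" "r - 1"] by (simp add: powr_divide)
    ultimately show ?thesis by (metis mult.assoc)
  qed
  then show "zygmund_fun C r s t / t \<le> zygmund_fun C r s u / u"
    using quot tu by simp
qed

abbreviation unit_norm :: "real \<Rightarrow> (real \<Rightarrow> real) \<Rightarrow> ennreal" where
  "unit_norm \<Delta> \<Phi> \<equiv> orlicz_norm \<Delta> \<Phi> (indicator {0<..<\<Delta>})"

lemma modular_unit:
  assumes "orlicz_like \<Phi>" "0 < \<Delta>"
  shows "(\<integral>\<^sup>+x\<in>{0<..<\<Delta>}. ennreal (\<Phi> (w * indicator {0<..<\<Delta>} x)) \<partial>lebesgue) = ennreal (\<Delta> * \<Phi> w)"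
proof -
  have "(\<integral>\<^sup>+x\<in>{0<..<\<Delta>}. ennreal (\<Phi> (w * indicator {0<..<\<Delta>} x)) \<partial>lebesgue) =
      (\<integral>\<^sup>+x\<in>{0<..<\<Delta>}. ennreal (\<Phi> w) \<partial>lebesgue)"
    by (intro nn_integral_cong) (auto simp: indicator_def)
  also have "\<dots> = ennreal (\<Phi> w) * ennreal \<Delta>"
    using assms(2) by (subst nn_integral_cmult_indicator) auto
  finally show ?thesis
    using assms orlicz_like_nonneg[OF assms(1)] by (simp add: ennreal_mult' mult.commute)
qed

lemma orlicz_norm_le:
  assumes "0 < v"
  shows "orlicz_norm \<Delta> \<Phi> h \<le>
    ennreal (1 / v) * (1 + (\<integral>\<^sup>+x\<in>{0<..<\<Delta>}. ennreal (\<Phi> (v * h x)) \<partial>lebesgue))"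
  unfolding orlicz_norm_def using assms by (intro INF_lower) auto

text \<open>Substitute \<open>w = v M\<close> in the infimum and use that \<open>\<Phi>\<close> is monotone in \<open>\<bar>u\<bar>\<close>.\<close>
lemma orlicz_norm_le_unit_norm:
  assumes \<Phi>: "orlicz_like \<Phi>" and M: "0 \<le> M"
    and h: "\<And>x. x \<in> {0<..<\<Delta>} \<Longrightarrow> \<bar>h x\<bar> \<le> M"
  shows "orlicz_norm \<Delta> \<Phi> h \<le> ennreal M * unit_norm \<Delta> \<Phi>"
proof (cases "M = 0")
  case True
  \<comment> \<open>Now the modular of \<open>h\<close> vanishes, and large \<open>v\<close> makes \<open>1 / v\<close> as small as desired.\<close>
  have small: "orlicz_norm \<Delta> \<Phi> h \<le> 0 + ennreal e" if "0 < e" for e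
  proof -
    have "(\<integral>\<^sup>+x\<in>{0<..<\<Delta>}. ennreal (\<Phi> (1 / e * h x)) \<partial>lebesgue) = (\<integral>\<^sup>+(x::real). 0 \<partial>lebesgue)"
      by (rule nn_integral_cong) (use h True \<Phi> in \<open>auto simp: indicator_def orlicz_like_def\<close>)
    then show ?thesis
      using orlicz_norm_le[of "1 / e" \<Delta> \<Phi> h] that by simp
  qed
  have "orlicz_norm \<Delta> \<Phi> h \<le> 0" by (rule ennreal_le_epsilon) (rule small)
  then show ?thesis by simp
next
  case False
  with M have M: "0 < M" by simp
  have "ennreal (1 / M) * orlicz_norm \<Delta> \<Phi> h \<le> unit_norm \<Delta> \<Phi>"
    unfolding orlicz_norm_def[of \<Delta> \<Phi> "indicator _"]
  proof (rule INF_greatest)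
    fix w :: real assume "w \<in> {0<..}"
    then have w: "0 < w" by simp
    have "ennreal (1 / M) * orlicz_norm \<Delta> \<Phi> h \<le>
        ennreal (1 / M) * (ennreal (1 / (w / M)) * (1 + (\<integral>\<^sup>+x\<in>{0<..<\<Delta>}. ennreal (\<Phi> (w / M * h x)) \<partial>lebesgue)))"
      using w M by (intro mult_left_mono orlicz_norm_le) auto
    also have "\<dots> = ennreal (1 / w) * (1 + (\<integral>\<^sup>+x\<in>{0<..<\<Delta>}. ennreal (\<Phi> (w / M * h x)) \<partial>lebesgue))"
      using w M by (simp flip: mult.assoc ennreal_mult')
    also have "\<dots> \<le> ennreal (1 / w) *
        (1 + (\<integral>\<^sup>+x\<in>{0<..<\<Delta>}. ennreal (\<Phi> (w * indicator {0<..<\<Delta>} x)) \<partial>lebesgue))"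
    proof (intro mult_left_mono add_left_mono nn_integral_mono)
      fix x
      have "\<Phi> (w / M * h x) \<le> \<Phi> w" if "x \<in> {0<..<\<Delta>}"
      proof (rule orlicz_like_mono[OF \<Phi>])
        have "w / M * \<bar>h x\<bar> \<le> w / M * M" using h[OF that] w M by (intro mult_left_mono) auto
        then show "\<bar>w / M * h x\<bar> \<le> \<bar>w\<bar>" using w M by (simp add: abs_mult)
      qed
      then show "ennreal (\<Phi> (w / M * h x)) * indicator {0<..<\<Delta>} x \<le>
          ennreal (\<Phi> (w * indicator {0<..<\<Delta>} x)) * indicator {0<..<\<Delta>} x"
        by (auto simp: indicator_def intro: ennreal_leI)
    qed auto
    finally show "ennreal (1 / M) * orlicz_norm \<Delta> \<Phi> h \<le> ennreal (1 / w) *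
        (1 + (\<integral>\<^sup>+x\<in>{0<..<\<Delta>}. ennreal (\<Phi> (w * indicator {0<..<\<Delta>} x)) \<partial>lebesgue))" .
  qed
  then have "ennreal M * (ennreal (1 / M) * orlicz_norm \<Delta> \<Phi> h) \<le> ennreal M * unit_norm \<Delta> \<Phi>"
    by (rule mult_left_mono) simp
  moreover have "ennreal M * (ennreal (1 / M) * orlicz_norm \<Delta> \<Phi> h) = orlicz_norm \<Delta> \<Phi> h"
    using M by (simp flip: mult.assoc ennreal_mult')
  ultimately show ?thesis by simp
qed

lemma fundamental_function_eq_unit_norm:
  assumes "orlicz_like \<Phi>" "0 < \<Delta>"
  shows "fundamental_function \<Delta> \<Phi> \<Delta> = unit_norm \<Delta> \<Phi>"
proof (rule antisym)
  show "fundamental_function \<Delta> \<Phi> \<Delta> \<le> unit_norm \<Delta> \<Phi>"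
    unfolding fundamental_function_def
  proof (rule SUP_least)
    fix A :: "real set"
    show "orlicz_norm \<Delta> \<Phi> (indicator A) \<le> unit_norm \<Delta> \<Phi>"
      using orlicz_norm_le_unit_norm[OF assms(1), of 1 \<Delta> "indicator A"] by (simp add: indicator_def)
  qed
  show "unit_norm \<Delta> \<Phi> \<le> fundamental_function \<Delta> \<Phi> \<Delta>"
    unfolding fundamental_function_def using assms(2) by (intro SUP_upper) auto
qed

lemma unit_norm_finite:
  assumes "orlicz_like \<Phi>" "0 < \<Delta>"
  shows "unit_norm \<Delta> \<Phi> < \<infinity>"
proof -
  have "unit_norm \<Delta> \<Phi> \<le> ennreal (1 / 1) * (1 + ennreal (\<Delta> * \<Phi> 1))"
    using orlicz_norm_le[of 1 \<Delta> \<Phi> "indicator {0<..<\<Delta>}"] unfolding modular_unit[OF assms] by simp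
  also have "\<dots> < \<infinity>" by (simp add: ennreal_mult_less_top)
  finally show ?thesis .
qed

text \<open>For \<open>v \<le> 1\<close> the term \<open>1 / v\<close> is at least 1; for \<open>v \<ge> 1\<close> the modular grows at least
  linearly in \<open>v\<close>.\<close>
lemma unit_norm_pos:
  assumes \<Phi>: "orlicz_like \<Phi>" and \<Delta>: "0 < \<Delta>"
  shows "0 < unit_norm \<Delta> \<Phi>"
proof -
  have \<Phi>1: "0 < \<Phi> 1" using \<Phi> by (simp add: orlicz_like_def)
  have "ennreal (min 1 (\<Delta> * \<Phi> 1)) \<le> unit_norm \<Delta> \<Phi>"
    unfolding orlicz_norm_def modular_unit[OF assms]
  proof (rule INF_greatest)
    fix v :: real assume "v \<in> {0<..}"
    then have v: "0 < v" by simp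
    have nn: "0 \<le> \<Delta> * \<Phi> v" using \<Delta> orlicz_like_nonneg[OF \<Phi>] by simp
    have "min 1 (\<Delta> * \<Phi> 1) \<le> 1 / v * (1 + \<Delta> * \<Phi> v)"
    proof (cases "v \<le> 1")
      case True
      have "1 \<le> 1 / v" using True v by simp
      also have "\<dots> \<le> 1 / v * (1 + \<Delta> * \<Phi> v)" using v nn by (simp add: field_simps)
      finally show ?thesis by simp
    next
      case False
      then have "\<Phi> 1 / 1 \<le> \<Phi> v / v" using \<Phi> unfolding orlicz_like_def by (metis le_cases zero_less_one)
      then have "\<Delta> * \<Phi> 1 \<le> \<Delta> * (\<Phi> v / v)" using \<Delta> by (intro mult_left_mono) auto
      also have "\<dots> \<le> 1 / v * (1 + \<Delta> * \<Phi> v)" using v by (simp add: field_simps)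
      finally show ?thesis by simp
    qed
    then have "ennreal (min 1 (\<Delta> * \<Phi> 1)) \<le> ennreal (1 / v * (1 + \<Delta> * \<Phi> v))" by (rule ennreal_leI)
    also have "\<dots> = ennreal (1 / v) * (1 + ennreal (\<Delta> * \<Phi> v))"
      using v nn by (subst ennreal_mult) (auto simp: ennreal_plus)
    finally show "ennreal (min 1 (\<Delta> * \<Phi> 1)) \<le> ennreal (1 / v) * (1 + ennreal (\<Delta> * \<Phi> v))" .
  qed
  moreover have "0 < ennreal (min 1 (\<Delta> * \<Phi> 1))" using \<Delta> \<Phi>1 by simp
  ultimately show ?thesis by (rule less_le_trans[rotated])
qed

text \<open>Jensen's inequality with a factor \<open>1 / 2\<close>: integrate the linear minorant of \<open>\<Phi>\<close> based at half
  the mean of \<open>v * \<bar>g\<bar>\<close>. Half of the mean is lost to the term \<open>- s\<close>, and the other half remains.\<close>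
lemma modular_ge_mean:
  assumes \<Phi>: "orlicz_like \<Phi>" and \<Delta>: "0 < \<Delta>" and g: "set_integrable lebesgue {0..\<Delta>} g"
    and v: "0 < v" and J: "(LINT x:{0..\<Delta>}|lebesgue. \<bar>g x\<bar>) / \<Delta> = J" "0 < J"
  shows "ennreal (\<Delta> * \<Phi> (v * J / 2)) \<le> (\<integral>\<^sup>+x\<in>{0<..<\<Delta>}. ennreal (\<Phi> (v * g x)) \<partial>lebesgue)"
proof -
  define s c where "s = v * J / 2" and "c = \<Phi> s / s"
  have s: "0 < s" using v J by (simp add: s_def)
  have abs: "set_integrable lebesgue {0..\<Delta>} (\<lambda>x. \<bar>g x\<bar>)" by (rule set_integrable_abs[OF g])
  have int: "set_integrable lebesgue {0..\<Delta>} (\<lambda>x. c * (v * \<bar>g x\<bar> - s))"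
    using abs by (intro set_integrable_mult_right set_integral_diff(1)) auto
  have const: "(LINT x:{0..\<Delta>}|lebesgue. s) = \<Delta> * s"
    using \<Delta> by (simp add: set_lebesgue_integral_def)
  have "(LINT x:{0..\<Delta>}|lebesgue. c * (v * \<bar>g x\<bar> - s)) = c * (v * (\<Delta> * J) - \<Delta> * s)"
    using abs J \<Delta> by (subst set_integral_mult_right, subst set_integral_diff(2)) (auto simp: const)
  also have "v * (\<Delta> * J) - \<Delta> * s = \<Delta> * s" by (simp add: s_def field_simps)
  also have "c * (\<Delta> * s) = \<Delta> * \<Phi> s" using s by (simp add: c_def)
  finally have eq: "(LINT x:{0..\<Delta>}|lebesgue. c * (v * \<bar>g x\<bar> - s)) = \<Delta> * \<Phi> s" .
  \<comment> \<open>The minorant takes negative values, so it passes to the nonnegative integral through its positive part.\<close>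
  define h where "h = (\<lambda>x. indicator {0..\<Delta>} x *\<^sub>R (c * (v * \<bar>g x\<bar> - s)))"
  have h: "integrable lebesgue h" using int by (simp add: set_integrable_def h_def)
  have "\<Delta> * \<Phi> s = integral\<^sup>L lebesgue h" using eq unfolding set_lebesgue_integral_def h_def by (rule sym)
  also have "\<dots> \<le> (LINT x|lebesgue. max 0 (h x))" using h by (intro integral_mono) auto
  finally have "ennreal (\<Delta> * \<Phi> s) \<le> ennreal (LINT x|lebesgue. max 0 (h x))" by (rule ennreal_leI)
  also have "\<dots> = (\<integral>\<^sup>+x. ennreal (max 0 (h x)) \<partial>lebesgue)"
    using h by (intro nn_integral_eq_integral[symmetric]) auto
  also have "\<dots> \<le> (\<integral>\<^sup>+x\<in>{0<..<\<Delta>}. ennreal (\<Phi> (v * g x)) \<partial>lebesgue)"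
  proof (rule nn_integral_mono_AE)
    have "AE x in lebesgue. x \<noteq> 0 \<and> x \<noteq> \<Delta>"
      by (rule AE_I[where N = "{0, \<Delta>}"]) (auto simp: emeasure_lborel_countable)
    then show "AE x in lebesgue. ennreal (max 0 (h x)) \<le> ennreal (\<Phi> (v * g x)) * indicator {0<..<\<Delta>} x"
    proof eventually_elim
      fix x :: real assume "x \<noteq> 0 \<and> x \<noteq> \<Delta>"
      moreover have "max 0 (c * (v * \<bar>g x\<bar> - s)) \<le> \<Phi> (v * g x)"
        using orlicz_like_linear_minorant[OF \<Phi> s, of "v * g x"] orlicz_like_nonneg[OF \<Phi>] v
        by (simp add: c_def abs_mult)
      ultimately show "ennreal (max 0 (h x)) \<le> ennreal (\<Phi> (v * g x)) * indicator {0<..<\<Delta>} x"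
        by (auto simp: h_def indicator_def intro: ennreal_leI)
    qed
  qed
  finally show ?thesis by (simp add: s_def)
qed

text \<open>Substitute \<open>w = v J / 2\<close> in the infimum.\<close>
lemma orlicz_norm_ge_mean:
  assumes \<Phi>: "orlicz_like \<Phi>" and \<Delta>: "0 < \<Delta>" and g: "set_integrable lebesgue {0..\<Delta>} g"
    and J: "(LINT x:{0..\<Delta>}|lebesgue. \<bar>g x\<bar>) / \<Delta> = J" "0 < J"
  shows "ennreal (J / 2) * unit_norm \<Delta> \<Phi> \<le> orlicz_norm \<Delta> \<Phi> g"
  unfolding orlicz_norm_def[of \<Delta> \<Phi> g]
proof (rule INF_greatest)
  fix v :: real assume "v \<in> {0<..}"
  then have v: "0 < v" by simp
  define w where "w = v * J / 2"
  have w: "0 < w" using v J by (simp add: w_def)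
  have "ennreal (J / 2) * unit_norm \<Delta> \<Phi> \<le> ennreal (J / 2) * (ennreal (1 / w) * (1 + ennreal (\<Delta> * \<Phi> w)))"
    using orlicz_norm_le[OF w, of \<Delta> \<Phi> "indicator {0<..<\<Delta>}"] unfolding modular_unit[OF \<Phi> \<Delta>]
    by (intro mult_left_mono) auto
  also have "\<dots> = ennreal (1 / v) * (1 + ennreal (\<Delta> * \<Phi> w))"
    using v w J by (simp add: w_def flip: mult.assoc ennreal_mult')
  also have "\<dots> \<le> ennreal (1 / v) * (1 + (\<integral>\<^sup>+x\<in>{0<..<\<Delta>}. ennreal (\<Phi> (v * g x)) \<partial>lebesgue))"
    unfolding w_def using modular_ge_mean[OF \<Phi> \<Delta> g v J] by (intro mult_left_mono add_left_mono) auto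
  finally show "ennreal (J / 2) * unit_norm \<Delta> \<Phi> \<le>
      ennreal (1 / v) * (1 + (\<integral>\<^sup>+x\<in>{0<..<\<Delta>}. ennreal (\<Phi> (v * g x)) \<partial>lebesgue))" .
qed

section \<open>The Wirtinger functional\<close>
lemma ennreal_inverse_antimono: "c \<le> d \<Longrightarrow> inverse d \<le> inverse (c :: ennreal)"
  by (simp add: inverse_ennreal.rep_eq less_eq_ennreal.rep_eq ereal_inverse_antimono)

lemma ennreal_divide_mono:
  fixes a b c d :: ennreal
  assumes "a \<le> b" "c \<le> d"
  shows "a / d \<le> b / c"
  unfolding divide_ennreal_def using assms by (intro mult_mono ennreal_inverse_antimono) auto

text \<open>Both fundamental functions at \<open>\<Delta>\<close> are norms of the constant 1. Let \<open>M = \<Delta> ^ n * J\<close>, where \<open>J\<close> is the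
  mean of \<open>\<bar>g\<bar>\<close>. Then \<open>\<bar>f\<bar> \<le> M\<close> bounds the first quotient by \<open>M\<close>, while the second is at least
  \<open>M / 2\<close> by Jensen's inequality.\<close>
lemma wirtinger_le_2:
  assumes X: "orlicz_like (zygmund_fun CX q \<gamma>)" and Y: "orlicz_like (zygmund_fun CY p (- \<beta>))"
    and \<Delta>: "0 < \<Delta>" and k: "k < n"
  shows "wirtinger CX CY \<gamma> \<beta> \<Delta> p q n k \<le> 2"
  unfolding wirtinger_def Let_def fundamental_function_eq_unit_norm[OF X \<Delta>]
    fundamental_function_eq_unit_norm[OF Y \<Delta>]
proof (rule SUP_least)
  fix f assume "f \<in> {f \<in> Z_class n k \<inter> L_plus q \<inter> L_minus p.
      \<not> (AE x in lebesgue. x \<in> {0..1} \<longrightarrow> gderiv 0 1 n f x = 0)}"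
  then have f: "f \<in> Z_class n k" by simp
  let ?X = "zygmund_fun CX q \<gamma>" and ?Y = "zygmund_fun CY p (- \<beta>)"
  define g J M where "g = gderiv 0 \<Delta> n (dilation \<Delta> f)"
    and "J = (LINT x:{0..\<Delta>}|lebesgue. \<bar>g x\<bar>) / \<Delta>" and "M = \<Delta> ^ n * J"
  have g: "set_integrable lebesgue {0..\<Delta>} g"
    unfolding g_def by (rule Z_class_sup_bound(1)[OF f k \<Delta>, of 0]) simp
  have fM: "\<bar>f x\<bar> \<le> M" if "x \<in> {0..1}" for x
    unfolding M_def J_def g_def by (rule Z_class_sup_bound(2)[OF f k \<Delta> that])
  have J0: "0 \<le> J"
    unfolding J_def set_lebesgue_integral_def using \<Delta> by (intro divide_nonneg_pos integral_nonneg) auto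
  have M0: "0 \<le> M" using J0 \<Delta> by (simp add: M_def)
  have num: "orlicz_norm \<Delta> ?X (dilation \<Delta> f) \<le> ennreal M * unit_norm \<Delta> ?X"
    using fM M0 by (intro orlicz_norm_le_unit_norm[OF X]) (auto simp: dilation_def)
  show "orlicz_norm \<Delta> ?X (dilation \<Delta> f) / unit_norm \<Delta> ?X /
      (ennreal (\<Delta> ^ n) * orlicz_norm \<Delta> ?Y (gderiv 0 \<Delta> n (dilation \<Delta> f)) / unit_norm \<Delta> ?Y) \<le> 2"
  proof (cases "J = 0")
    case True
    \<comment> \<open>The numerator vanishes, and \<open>0 / x = 0\<close> for every \<open>x\<close>, including 0.\<close>
    then show ?thesis using num by (simp add: M_def)
  next
    case False
    then have J: "0 < J" using J0 by simp
    have M: "0 < M" using J \<Delta> by (simp add: M_def)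
    have cancel: "a * u / u = a" if "u = unit_norm \<Delta> \<Phi>" "orlicz_like \<Phi>" for a u :: ennreal and \<Phi>
      using unit_norm_pos[OF that(2) \<Delta>] unit_norm_finite[OF that(2) \<Delta>] that(1)
      by (simp add: ennreal_mult_divide_eq)
    have A: "orlicz_norm \<Delta> ?X (dilation \<Delta> f) / unit_norm \<Delta> ?X \<le> ennreal M"
      using divide_right_mono_ennreal[OF num, of "unit_norm \<Delta> ?X"] cancel[OF refl X] by simp
    have "ennreal (M / 2) * unit_norm \<Delta> ?Y = ennreal (\<Delta> ^ n) * (ennreal (J / 2) * unit_norm \<Delta> ?Y)"
      using \<Delta> J by (simp add: M_def flip: mult.assoc ennreal_mult')
    also have "\<dots> \<le> ennreal (\<Delta> ^ n) * orlicz_norm \<Delta> ?Y g"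
      by (intro mult_left_mono orlicz_norm_ge_mean[OF Y \<Delta> g J_def[symmetric] J]) auto
    finally have "ennreal (M / 2) * unit_norm \<Delta> ?Y / unit_norm \<Delta> ?Y \<le>
        ennreal (\<Delta> ^ n) * orlicz_norm \<Delta> ?Y g / unit_norm \<Delta> ?Y"
      by (rule divide_right_mono_ennreal)
    then have B: "ennreal (M / 2) \<le> ennreal (\<Delta> ^ n) * orlicz_norm \<Delta> ?Y g / unit_norm \<Delta> ?Y"
      unfolding cancel[OF refl Y] .
    have "orlicz_norm \<Delta> ?X (dilation \<Delta> f) / unit_norm \<Delta> ?X /
        (ennreal (\<Delta> ^ n) * orlicz_norm \<Delta> ?Y g / unit_norm \<Delta> ?Y) \<le> ennreal M / ennreal (M / 2)"
      by (rule ennreal_divide_mono[OF A B])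
    also have "\<dots> = 2" using M by (simp add: divide_ennreal)
    finally show ?thesis by (simp add: g_def)
  qed
qed

theorem theorem5p1:
  "\<exists>C0 :: real \<Rightarrow> real \<Rightarrow> real.
     \<forall>(n::nat) (k::nat) (p::real) (q::real) (\<gamma>::real) (\<beta>::real) (CX::real) (CY::real).
       2 \<le> n \<longrightarrow> k < n \<longrightarrow> 1 < p \<longrightarrow> 1 \<le> q \<longrightarrow> 0 \<le> \<gamma> \<longrightarrow> 0 \<le> \<beta> \<longrightarrow>
       C0 q \<gamma> \<le> CX \<longrightarrow> C0 p (- \<beta>) \<le> CY \<longrightarrow>
       (SUP \<Delta>\<in>{0<..}. wirtinger CX CY \<gamma> \<beta> \<Delta> p q n k) < \<infinity>"
\<comment> \<open>For \<open>r = 1\<close>, which occurs for \<open>X\<close> only, the quotient is 0 and the constant is \<open>exp 1\<close>.\<close>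
proof (rule exI[of _ "\<lambda>r s. exp (1 + \<bar>s\<bar> / (r - 1))"], intro allI impI)
  fix n k :: nat and p q \<gamma> \<beta> CX CY :: real
  assume *: "2 \<le> n" "k < n" "1 < p" "1 \<le> q" "0 \<le> \<gamma>" "0 \<le> \<beta>"
    "exp (1 + \<bar>\<gamma>\<bar> / (q - 1)) \<le> CX" "exp (1 + \<bar>- \<beta>\<bar> / (p - 1)) \<le> CY"
  have "orlicz_like (zygmund_fun CX q \<gamma>)" "orlicz_like (zygmund_fun CY p (- \<beta>))"
    using * by (auto intro!: orlicz_like_zygmund_fun)
  then have "(SUP \<Delta>\<in>{0<..}. wirtinger CX CY \<gamma> \<beta> \<Delta> p q n k) \<le> 2"
    using * by (intro SUP_least wirtinger_le_2) auto
  also have "\<dots> < \<infinity>" by simp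
  finally show "(SUP \<Delta>\<in>{0<..}. wirtinger CX CY \<gamma> \<beta> \<Delta> p q n k) < \<infinity>" .
qed

end
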